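(* Let $p\geq 1$ be an integer and let $l>0$. Among all $p$-sided polygonal cusps with fixed perimeter $l$, the regular one, with interior angle $$\theta=2\sin^{-1}\big(\operatorname{sech}(l/2p)\big)$$ at each vertex, has the maximum area.
   Context: Polygonal cusp: take a collection of $p$ hyperbolic triangles, each having exactly one ideal vertex (so each has one side of finite length, opposite to the ideal vertex, and two sides of infinite length). Arrange them cyclically and glue, by isometries matching the non-ideal endpoints, one infinite side of each triangle to an infinite side of the next one, so that the result is a once-punctured disk (all ideal vertices being identified to the puncture) with a hyperbolic metric and a piecewise geodesic boundary of finite length made of the $p$ finite sides. Such an object is a $p$-sided polygonal cusp, and the boundary geodesic segments are its sides. If the $i$-th triangle has finite side of length $l_i$ and non-ideal angles $\theta_i,\phi_i$, then the side lengths of the polygonal cusp are the $l_i$ and its interior angles are $\phi_{i-1}+\theta_i$ (indices mod $p$). The perimeter is the sum of the side lengths; the area is the hyperbolic area. A polygonal cusp is called regular if all its side lengths are equal and all its interior angles are equal. $\operatorname{sech}=1/\cosh$. *)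

theory Defs
  imports "HOL-Analysis.Analysis"
begin

section \<open>The hyperbolic plane\<close>

text \<open>
  The hyperbolic plane (curvature -1) is the Poincare disk: its points are the complex numbers
  of norm less than 1, its ideal points those of norm 1.
  The map \<open>toward w\<close> is the disk isometry that takes \<open>w\<close> to the
  centre (up to a rotation); it also makes sense at ideal points.  Its complex derivative at
  \<open>w\<close> is a positive real, so \<open>toward w z\<close> points in the initial direction of the
  geodesic from \<open>w\<close> to \<open>z\<close>, and that geodesic becomes a straight line from the centre.
\<close>

definition toward :: "complex \<Rightarrow> complex \<Rightarrow> complex" where
  "toward w z = (z - w) / (1 - cnj w * z)"

definition hyp_dist :: "complex \<Rightarrow> complex \<Rightarrow> real" where
  "hyp_dist w z = 2 * artanh (norm (toward w z))"

text \<open>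
  The geodesic segment from \<open>w\<close> to \<open>z\<close> if \<open>z\<close> is in the disk, and the geodesic ray from \<open>w\<close> to
  \<open>z\<close> (without its endpoint at infinity) if \<open>z\<close> is ideal.
\<close>

definition geodesic :: "complex \<Rightarrow> complex \<Rightarrow> complex set" where
  "geodesic w z =
     {x. norm x < 1 \<and> (\<exists>t. 0 \<le> t \<and> t \<le> 1 \<and> toward w x = complex_of_real t * toward w z)}"

definition hyp_angle :: "complex \<Rightarrow> complex \<Rightarrow> complex \<Rightarrow> real" where
  "hyp_angle y w z = \<bar>Arg (toward w y / toward w z)\<bar>"  \<comment> \<open>the angle at \<open>w\<close>\<close>

definition hyp_area :: "complex set \<Rightarrow> real" where
  "hyp_area S = (LINT z:S|lebesgue. 4 / (1 - (norm z)\<^sup>2)\<^sup>2)"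

definition sech :: "real \<Rightarrow> real" where
  "sech x = 1 / cosh x"

section \<open>Triangles with exactly one ideal vertex\<close>

datatype triangle = Triangle (fst_vertex: complex) (snd_vertex: complex) (ideal_vertex: complex)

text \<open>The last conjunct says that the three vertices do not lie on a common geodesic.\<close>

definition cusp_triangle :: "triangle \<Rightarrow> bool" where
  "cusp_triangle T \<longleftrightarrow>
     norm (fst_vertex T) < 1 \<and> norm (snd_vertex T) < 1 \<and> norm (ideal_vertex T) = 1 \<and>
     toward (fst_vertex T) (snd_vertex T) / toward (fst_vertex T) (ideal_vertex T) \<notin> \<real>"

definition finite_side_length :: "triangle \<Rightarrow> real" where
  "finite_side_length T = hyp_dist (fst_vertex T) (snd_vertex T)"

definition fst_angle :: "triangle \<Rightarrow> real" where
  "fst_angle T = hyp_angle (snd_vertex T) (fst_vertex T) (ideal_vertex T)"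

definition snd_angle :: "triangle \<Rightarrow> real" where
  "snd_angle T = hyp_angle (fst_vertex T) (snd_vertex T) (ideal_vertex T)"

definition region :: "triangle \<Rightarrow> complex set" where
  "region T = (\<Union>w\<in>geodesic (fst_vertex T) (snd_vertex T). geodesic w (ideal_vertex T))"

text \<open>
  The signed distance between the horocycles centred at the ideal vertex through the two finite
  vertices (difference of the values of the Busemann function at these vertices).
\<close>

definition busemann :: "complex \<Rightarrow> complex \<Rightarrow> real" where
  "busemann \<xi> z = ln ((norm (\<xi> - z))\<^sup>2 / (1 - (norm z)\<^sup>2))"

definition horocyclic_shift :: "triangle \<Rightarrow> real" where
  "horocyclic_shift T =
     busemann (ideal_vertex T) (snd_vertex T) - busemann (ideal_vertex T) (fst_vertex T)"

section \<open>Polygonal cusps\<close>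

text \<open>
  A \<open>p\<close>-sided polygonal cusp is given by the cyclic list of its triangles.  The infinite side of
  the \<open>i\<close>-th triangle at its second vertex is glued to the infinite side of the triangle
  \<open>i + 1\<close> (modulo \<open>p\<close>) at its first vertex.  Matching the non-ideal endpoints determines the
  gluing isometry of the two rays, so the list determines the glued surface up to isometry.
  The glued sides have measure zero, so the area of the surface is the sum of the areas of the
  triangles.
\<close>

definition polygonal_cusp :: "nat \<Rightarrow> triangle list \<Rightarrow> bool" where
  "polygonal_cusp p C \<longleftrightarrow> 1 \<le> p \<and> length C = p \<and> (\<forall>T\<in>set C. cusp_triangle T)"

definition side_length :: "triangle list \<Rightarrow> nat \<Rightarrow> real" where
  "side_length C i = finite_side_length (C ! i)"

text \<open>The vertex \<open>i\<close> is where the triangle \<open>i - 1\<close> (modulo \<open>p\<close>) meets the triangle \<open>i\<close>.\<close>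

definition interior_angle :: "triangle list \<Rightarrow> nat \<Rightarrow> real" where
  "interior_angle C i =
     snd_angle (C ! ((i + length C - 1) mod length C)) + fst_angle (C ! i)"

definition perimeter :: "triangle list \<Rightarrow> real" where
  "perimeter C = (\<Sum>i<length C. side_length C i)"

definition cusp_area :: "triangle list \<Rightarrow> real" where
  "cusp_area C = (\<Sum>i<length C. hyp_area (region (C ! i)))"

definition regular_cusp :: "triangle list \<Rightarrow> bool" where
  "regular_cusp C \<longleftrightarrow>
     (\<forall>i<length C. \<forall>j<length C.
        side_length C i = side_length C j \<and> interior_angle C i = interior_angle C j)"

text \<open>
  The gluing alone does not force the metric to be complete at the puncture.  It is complete,
  so that the puncture is a genuine cusp (parabolic holonomy), iff the horocycle pieces in the
  successive triangles close up after one turn around the puncture.  Without this condition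
  there are further gluings with equal sides and equal interior angles (for \<open>p = 1\<close>, glue the two
  infinite sides of any triangle), so it is needed to speak of the regular polygonal cusp.
\<close>

definition complete_at_puncture :: "triangle list \<Rightarrow> bool" where
  "complete_at_puncture C \<longleftrightarrow> (\<Sum>i<length C. horocyclic_shift (C ! i)) = 0"

end

theory Submission
  imports Defs
begin

text \<open>
  In the upper half-plane with the ideal vertex at infinity and the finite side on the unit circle,
  the finite vertices are \<open>exp (2 * \<i> * arctan a)\<close> and \<open>exp (2 * \<i> * arctan b)\<close>.  After a reflection
  \<open>a < b\<close>; then the finite side has length \<open>ln b - ln a\<close>, the angles are \<open>2 * arctan a\<close> and
  \<open>pi - 2 * arctan b\<close>, and the area is \<open>2 * arctan b - 2 * arctan a\<close>.  By the addition formula for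
  \<open>arctan\<close> and AM-GM the area for a given length \<open>L\<close> is at most \<open>2 * arctan (sinh (L / 2))\<close>, attained
  for \<open>a * b = 1\<close>.  This bound is a concave function of \<open>L\<close>, so equal sides are optimal.

  In a regular cusp all triangles have the same \<open>b / a\<close>, and equality of the interior angles turns the
  sequence of the parameters \<open>a\<close> into a periodic orbit of an increasing map, which must be constant.
  Completeness then forces the common horocyclic shift to vanish, that is, \<open>a * b = 1\<close>.
\<close>

section \<open>Integrals over the complex plane\<close>

text \<open>Links the plane to \<open>real^2\<close>, where the Jacobian change of variables is
  stated. Open boxes correspond to open boxes with the same product of side lengths, and this
  characterises Lebesgue measure.\<close>

lemma lborel_complex_eq_distr_cart:
  "(lborel :: complex measure) = distr lborel borel (\<lambda>x::real^2. Complex (x $ 1) (x $ 2))"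
proof (rule lborel_eqI)
  fix l u :: complex
  assume le: "\<And>b. b \<in> Basis \<Longrightarrow> l \<bullet> b \<le> u \<bullet> b"
  have le': "Re l \<le> Re u" "Im l \<le> Im u"
    using le[of 1] le[of \<i>] by auto
  have meas: "(\<lambda>x::real^2. Complex (x $ 1) (x $ 2)) \<in> borel_measurable lborel"
    by (simp add: borel_measurable_continuous_onI continuous_on_Complex continuous_on_component)
  have vim: "(\<lambda>x::real^2. Complex (x $ 1) (x $ 2)) -` box l u
      = box (vector [Re l, Im l]) (vector [Re u, Im u])"
    by (auto simp: box_def Basis_complex_def Basis_vec_def inner_axis forall_2)
  have "emeasure (distr lborel borel (\<lambda>x::real^2. Complex (x $ 1) (x $ 2))) (box l u)
      = emeasure lborel (box (vector [Re l, Im l]) (vector [Re u, Im u]) :: (real^2) set)"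
    using meas by (simp add: emeasure_distr vim)
  also have "\<dots> = ennreal (\<Prod>b\<in>Basis. (vector [Re u, Im u] - vector [Re l, Im l] :: real^2) \<bullet> b)"
    using le' by (intro emeasure_lborel_box) (auto simp: Basis_vec_def inner_axis forall_2 UNIV_2)
  also have "(\<Prod>b\<in>Basis. (vector [Re u, Im u] - vector [Re l, Im l] :: real^2) \<bullet> b)
      = (Re u - Re l) * (Im u - Im l)"
    by (simp add: Basis_vec_def UNIV_2 inner_axis axis_eq_axis)
  also have "\<dots> = (\<Prod>b\<in>Basis. (u - l) \<bullet> b)"
    by (simp add: Basis_complex_def)
  finally show "emeasure (distr lborel borel (\<lambda>x::real^2. Complex (x $ 1) (x $ 2))) (box l u)
      = ennreal (\<Prod>b\<in>Basis. (u - l) \<bullet> b)" .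
qed simp

lemma borel_measurable_Complex_pair:
  "(\<lambda>(x, y). Complex x y) \<in> borel_measurable (lborel \<Otimes>\<^sub>M lborel)"
  unfolding lborel_prod
  by (simp add: borel_measurable_continuous_onI continuous_on_Complex case_prod_beta
      continuous_on_fst continuous_on_snd)

text \<open>The product form serves Tonelli: integrals over the plane become iterated integrals over
  the imaginary and real parts.\<close>

lemma lborel_complex_eq_distr_prod:
  "(lborel :: complex measure) = distr (lborel \<Otimes>\<^sub>M lborel) borel (\<lambda>(x, y). Complex x y)"
proof (rule lborel_eqI)
  fix l u :: complex
  assume le: "\<And>b. b \<in> Basis \<Longrightarrow> l \<bullet> b \<le> u \<bullet> b"
  have le': "Re l \<le> Re u" "Im l \<le> Im u"
    using le[of 1] le[of \<i>] by auto
  note meas = borel_measurable_Complex_pair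
  have vim: "(\<lambda>(x, y). Complex x y) -` box l u = {Re l<..<Re u} \<times> {Im l<..<Im u}"
    by (auto simp: box_def Basis_complex_def)
  have "emeasure (distr (lborel \<Otimes>\<^sub>M lborel) borel (\<lambda>(x, y). Complex x y)) (box l u)
      = emeasure (lborel \<Otimes>\<^sub>M lborel) ({Re l<..<Re u} \<times> {Im l<..<Im u})"
    using meas by (subst emeasure_distr) (auto simp: vim space_pair_measure)
  also have "\<dots> = ennreal ((Re u - Re l) * (Im u - Im l))"
    using le' by (subst lborel.emeasure_pair_measure_Times) (auto simp: ennreal_mult)
  also have "(Re u - Re l) * (Im u - Im l) = (\<Prod>b\<in>Basis. (u - l) \<bullet> b)"
    by (simp add: Basis_complex_def)
  finally show "emeasure (distr (lborel \<Otimes>\<^sub>M lborel) borel (\<lambda>(x, y). Complex x y)) (box l u)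
      = ennreal (\<Prod>b\<in>Basis. (u - l) \<bullet> b)" .
qed simp

text \<open>A real function is treated as a vector function into \<open>real^1\<close>.\<close>

lemma has_absolute_integral_change_of_variables_scalar:
  fixes f :: "real^'m::{finite,wellorder} \<Rightarrow> real" and g :: "real^'m::_ \<Rightarrow> real^'m::_"
  assumes "S \<in> sets lebesgue"
    and "\<And>x. x \<in> S \<Longrightarrow> (g has_derivative g' x) (at x within S)"
    and "inj_on g S"
  shows "(\<lambda>x. \<bar>det (matrix (g' x))\<bar> * f (g x)) absolutely_integrable_on S \<and>
           integral S (\<lambda>x. \<bar>det (matrix (g' x))\<bar> * f (g x)) = b
     \<longleftrightarrow> f absolutely_integrable_on (g ` S) \<and> integral (g ` S) f = b"
  using has_absolute_integral_change_of_variables[OF assms, of "\<lambda>x. vec (f x) :: real^1" "vec b"]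
  by (simp add: absolutely_integrable_on_1_iff integral_on_1_eq)

text \<open>Translates between Lebesgue integrals over the plane and gauge integrals over
  \<open>real^2\<close>, the language of the change of variables formula.\<close>

lemma set_lebesgue_integral_complex_cart:
  fixes f :: "complex \<Rightarrow> real" and S :: "complex set"
  assumes R_def: "R = (\<lambda>x::real^2. Complex (x $ 1) (x $ 2))"
    and S: "S \<in> sets borel" and f: "f \<in> borel_measurable borel"
  shows "set_integrable lborel S f \<longleftrightarrow> (\<lambda>x. f (R x)) absolutely_integrable_on (R -` S)"
    and "set_integrable lborel S f \<Longrightarrow> (LINT z:S|lborel. f z) = integral (R -` S) (\<lambda>x. f (R x))"
proof -
  have R: "R \<in> borel_measurable lborel"
    unfolding R_def
    by (simp add: borel_measurable_continuous_onI continuous_on_Complex continuous_on_component)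
  have d: "lborel = distr lborel borel R"
    unfolding R_def by (rule lborel_complex_eq_distr_cart)
  have ind: "indicator (R -` S) x = (indicator S (R x) :: real)" for x
    by (simp add: indicator_def)
  have m: "(\<lambda>x. indicator S x *\<^sub>R f x) \<in> borel_measurable borel"
    using S f by simp
  have m': "(\<lambda>x. indicator S (R x) *\<^sub>R f (R x)) \<in> borel_measurable lborel"
    using measurable_compose[OF R m] by simp
  show i: "set_integrable lborel S f \<longleftrightarrow> (\<lambda>x. f (R x)) absolutely_integrable_on (R -` S)"
    unfolding set_integrable_def ind
    by (subst d, subst integrable_distr_eq[OF _ m]) (use R m' in \<open>auto simp: integrable_completion\<close>)
  assume "set_integrable lborel S f"
  with i have "(LINT x:R -` S|lebesgue. f (R x)) = integral (R -` S) (\<lambda>x. f (R x))"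
    by (intro set_lebesgue_integral_eq_integral) simp
  moreover have "(LINT x:R -` S|lebesgue. f (R x)) = (LINT z:S|lborel. f z)"
    unfolding set_lebesgue_integral_def ind
    by (subst d, subst integral_distr[OF _ m]) (use R m' in \<open>auto simp: integral_completion\<close>)
  ultimately show "(LINT z:S|lborel. f z) = integral (R -` S) (\<lambda>x. f (R x))"
    by simp
qed

text \<open>The real Jacobian of a complex-differentiable map is the squared modulus of its
  derivative. The map is conjugated by the identification \<open>R\<close> of \<open>real^2\<close>
  with the plane and its inverse \<open>V\<close>.\<close>

theorem complex_change_of_variables:
  fixes f :: "complex \<Rightarrow> real" and g :: "complex \<Rightarrow> complex"
  assumes S: "S \<in> sets borel" "g ` S \<in> sets borel"
    and meas: "f \<in> borel_measurable borel" "(\<lambda>z. (norm (g' z))\<^sup>2 * f (g z)) \<in> borel_measurable borel"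
    and der: "\<And>z. z \<in> S \<Longrightarrow> (g has_field_derivative g' z) (at z within S)"
    and inj: "inj_on g S"
    and int: "set_integrable lborel S (\<lambda>z. (norm (g' z))\<^sup>2 * f (g z))"
  shows "(LINT z:g ` S|lborel. f z) = (LINT z:S|lborel. (norm (g' z))\<^sup>2 * f (g z))"
proof -
  define R where "R = (\<lambda>x::real^2. Complex (x $ 1) (x $ 2))"
  define V where "V = (\<lambda>z. vector [Re z, Im z] :: real^2)"
  have RV [simp]: "R (V z) = z" for z by (simp add: R_def V_def)
  have VR [simp]: "V (R x) = x" for x by (simp add: R_def V_def vec_eq_iff forall_2)
  have linR: "bounded_linear R"
    by (auto intro!: linear_conv_bounded_linear[THEN iffD1] linearI simp: R_def complex_eq_iff)
  have linV: "bounded_linear V"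
    by (auto intro!: linear_conv_bounded_linear[THEN iffD1] linearI simp: V_def vec_eq_iff forall_2)
  define G where "G = (\<lambda>x. V (g (R x)))"
  define G' where "G' = (\<lambda>x h. V (g' (R x) * R h))"
  have RS: "R ` (R -` S) = S" by (metis RV surj_image_vimage_eq surjI)
  have GS: "G ` (R -` S) = R -` (g ` S)"
    unfolding G_def by (auto simp: image_iff) (metis RV VR vimageI)
  \<comment> \<open>Multiplication by \<open>u + i v\<close> has a matrix with determinant
    \<open>u * u + v * v\<close>.\<close>
  have det: "det (matrix (G' x)) = (norm (g' (R x)))\<^sup>2" for x
    unfolding cmod_power2
    by (simp add: det_2 matrix_def G'_def R_def V_def axis_def power2_eq_square)
  have Sb: "R -` S \<in> sets lebesgue"
  proof -
    have "R \<in> borel_measurable borel"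
      using linR by (simp add: borel_measurable_continuous_onI linear_continuous_on)
    from measurable_sets[OF this S(1)] show ?thesis by auto
  qed
  have dG: "(G has_derivative G' x) (at x within R -` S)" if "x \<in> R -` S" for x
  proof -
    have "(g has_derivative (\<lambda>h. g' (R x) * h)) (at (R x) within R ` (R -` S))"
      unfolding RS by (rule der[unfolded has_field_derivative_def]) (use that in simp)
    from has_derivative_in_compose[OF bounded_linear_imp_has_derivative[OF linR] this]
    have "((\<lambda>x. g (R x)) has_derivative (\<lambda>h. g' (R x) * R h)) (at x within R -` S)" .
    from bounded_linear.has_derivative[OF linV this] show ?thesis
      by (simp add: G_def G'_def)
  qed
  have iG: "inj_on G (R -` S)"
    using inj unfolding inj_on_def G_def by (metis RV VR vimage_eq)
  have "(\<lambda>x. \<bar>det (matrix (G' x))\<bar> * f (R (G x))) absolutely_integrable_on (R -` S)"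
    and I: "(LINT z:S|lborel. (norm (g' z))\<^sup>2 * f (g z))
      = integral (R -` S) (\<lambda>x. \<bar>det (matrix (G' x))\<bar> * f (R (G x)))"
    using set_lebesgue_integral_complex_cart[OF R_def S(1) meas(2)] int
    by (simp_all add: det G_def)
  then have "(\<lambda>x. f (R x)) absolutely_integrable_on (R -` (g ` S))"
    and I': "integral (R -` (g ` S)) (\<lambda>x. f (R x))
      = integral (R -` S) (\<lambda>x. \<bar>det (matrix (G' x))\<bar> * f (R (G x)))"
    using has_absolute_integral_change_of_variables_scalar[OF Sb dG iG, of "\<lambda>x. f (R x)"
        "integral (R -` S) (\<lambda>x. \<bar>det (matrix (G' x))\<bar> * f (R (G x)))"]
    unfolding GS by blast+
  then show ?thesis
    using set_lebesgue_integral_complex_cart[OF R_def S(2) meas(1)] I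
    by simp
qed

lemma two_arctan_in: "0 < a \<Longrightarrow> 0 < 2 * arctan a \<and> 2 * arctan (a::real) < pi"
  using arctan_ubound[of a] by auto

lemma cos_two_arctan: "cos (2 * arctan x) = (1 - x\<^sup>2) / (1 + x\<^sup>2)"
  and sin_two_arctan: "sin (2 * arctan x) = 2 * x / (1 + x\<^sup>2)"
proof -
  have p: "1 + x\<^sup>2 > 0" by (simp add: add_pos_nonneg)
  have q: "sqrt (1 + x\<^sup>2) * sqrt (1 + x\<^sup>2) = 1 + x\<^sup>2" using p by simp
  show "cos (2 * arctan x) = (1 - x\<^sup>2) / (1 + x\<^sup>2)"
    using p by (simp add: cos_double cos_arctan sin_arctan power_divide diff_divide_distrib)
  show "sin (2 * arctan x) = 2 * x / (1 + x\<^sup>2)"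
    using p q by (simp add: sin_double cos_arctan sin_arctan)
qed

section \<open>Hyperbolic area above an arc of the unit semicircle\<close>

definition half_plane_strip :: "real \<Rightarrow> real \<Rightarrow> complex set" where
  "half_plane_strip u v = {Z. u \<le> Re Z \<and> Re Z \<le> v \<and> 0 < Im Z \<and> 1 \<le> (Re Z)\<^sup>2 + (Im Z)\<^sup>2}"

lemma half_plane_strip_borel [measurable]: "half_plane_strip u v \<in> sets borel"
  unfolding half_plane_strip_def by measurable

lemma nn_integral_inverse_square_atLeast:
  fixes s :: real
  assumes "0 < s"
  shows "(\<integral>\<^sup>+y. ennreal (1 / y\<^sup>2) * indicator {s..} y \<partial>lborel) = ennreal (1 / s)"
proof -
  have "((\<lambda>y::real. - inverse y) \<longlongrightarrow> 0) at_top"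
    using tendsto_minus[OF tendsto_inverse_0_at_top[OF filterlim_ident]] by simp
  then have "(\<integral>\<^sup>+y. ennreal (1 / y\<^sup>2) * indicator {s..} y \<partial>lborel) = 0 - (- inverse s)"
    using assms
    by (intro nn_integral_FTC_atLeast)
      (auto intro!: derivative_eq_intros simp: field_simps power2_eq_square)
  then show ?thesis by (simp add: inverse_eq_divide)
qed

text \<open>Integrating the density vertically from the semicircle upwards leaves the derivative of
  \<open>arcsin\<close>. The computation runs with nonnegative integrals, so the finite value also
  yields integrability.\<close>

lemma area_half_plane_strip:
  assumes uv: "-1 < u" "u \<le> v" "v < 1"
  shows "set_integrable lborel (half_plane_strip u v) (\<lambda>Z. 1 / (Im Z)\<^sup>2)"
    and "(LINT Z:half_plane_strip u v|lborel. 1 / (Im Z)\<^sup>2) = arcsin v - arcsin u"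
proof -
  let ?f = "\<lambda>Z. ennreal (indicator (half_plane_strip u v) Z * (1 / (Im Z)\<^sup>2))"
  have m: "(\<lambda>Z. indicator (half_plane_strip u v) Z * (1 / (Im Z)\<^sup>2)) \<in> borel_measurable borel"
    by measurable
  note m2 = borel_measurable_Complex_pair
  have inner: "(\<integral>\<^sup>+y. ?f (Complex x y) \<partial>lborel)
      = ennreal (1 / sqrt (1 - x\<^sup>2)) * indicator {u..v} x" for x
  proof (cases "x \<in> {u..v}")
    case True
    then have "\<bar>x\<bar> < 1" using uv by auto
    then have x: "x\<^sup>2 < 1" by (simp add: abs_square_less_1)
    define s where "s = sqrt (1 - x\<^sup>2)"
    have s: "0 < s" "s\<^sup>2 = 1 - x\<^sup>2" using x by (auto simp: s_def)
    \<comment> \<open>Positivity of \<open>y\<close> selects the upper of the two half-lines outside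
      the circle.\<close>
    have "0 < y \<and> 1 \<le> x\<^sup>2 + y\<^sup>2 \<longleftrightarrow> s \<le> y" for y
    proof -
      have "1 \<le> x\<^sup>2 + y\<^sup>2 \<longleftrightarrow> s\<^sup>2 \<le> y\<^sup>2" using s by auto
      then show ?thesis
        using s(1) abs_le_square_iff[of s y] by auto
    qed
    with True have "Complex x y \<in> half_plane_strip u v \<longleftrightarrow> y \<in> {s..}" for y
      by (auto simp: half_plane_strip_def)
    then have "?f (Complex x y) = ennreal (1 / y\<^sup>2) * indicator {s..} y" for y
      by (auto simp: indicator_def)
    then show ?thesis
      using nn_integral_inverse_square_atLeast[OF s(1)] True by (simp add: s_def)
  next
    case False
    then have "indicator (half_plane_strip u v) (Complex x y) = (0 :: real)" for y
      by (auto simp: half_plane_strip_def indicator_def)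
    with False show ?thesis by simp
  qed
  have "(\<integral>\<^sup>+Z. ?f Z \<partial>lborel) = (\<integral>\<^sup>+p. ?f (case p of (x, y) \<Rightarrow> Complex x y) \<partial>(lborel \<Otimes>\<^sub>M lborel))"
    by (subst lborel_complex_eq_distr_prod, subst nn_integral_distr[OF m2]) (use m in simp_all)
  also have "\<dots> = (\<integral>\<^sup>+x. \<integral>\<^sup>+y. ?f (Complex x y) \<partial>lborel \<partial>lborel)"
    by (subst lborel.nn_integral_fst[symmetric])
      (use measurable_compose[OF m2 m] in \<open>auto simp: case_prod_beta\<close>)
  also have "\<dots> = (\<integral>\<^sup>+x. ennreal (1 / sqrt (1 - x\<^sup>2)) * indicator {u..v} x \<partial>lborel)"
    by (simp only: inner)
  also have "\<dots> = ennreal (arcsin v - arcsin u)"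
  proof (rule nn_integral_FTC_Icc)
    show "(\<lambda>x. 1 / sqrt (1 - x\<^sup>2)) \<in> borel_measurable borel" by simp
    fix x assume "x \<in> {u..v}"
    then have x: "-1 < x" "x < 1" using uv by auto
    show "(arcsin has_real_derivative 1 / sqrt (1 - x\<^sup>2)) (at x)"
      using DERIV_arcsin[OF x] by (simp only: inverse_eq_divide)
    show "0 \<le> 1 / sqrt (1 - x\<^sup>2)"
      using x by (simp add: abs_square_le_1)
  qed (use uv in auto)
  finally have eq: "(\<integral>\<^sup>+Z. ?f Z \<partial>lborel) = ennreal (arcsin v - arcsin u)" .
  have "arcsin u \<le> arcsin v" using uv by (intro arcsin_le_arcsin) auto
  then have "has_bochner_integral lborel
      (\<lambda>Z. indicator (half_plane_strip u v) Z * (1 / (Im Z)\<^sup>2)) (arcsin v - arcsin u)"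
    using m eq by (intro has_bochner_integral_nn_integral) auto
  then show "set_integrable lborel (half_plane_strip u v) (\<lambda>Z. 1 / (Im Z)\<^sup>2)"
    and "(LINT Z:half_plane_strip u v|lborel. 1 / (Im Z)\<^sup>2) = arcsin v - arcsin u"
    by (simp_all add: set_integrable_def set_lebesgue_integral_def has_bochner_integral_iff)
qed

section \<open>The half-plane model\<close>

text \<open>
  For \<open>r > 0\<close> this is an isometry of the disk onto the upper half-plane that takes \<open>\<xi>\<close> to infinity.
  The parameters \<open>c\<close> and \<open>r\<close> serve to move a given geodesic to the unit semicircle.
\<close>

definition to_half_plane :: "complex \<Rightarrow> real \<Rightarrow> real \<Rightarrow> complex \<Rightarrow> complex" where
  "to_half_plane \<xi> c r z = (\<i> * (\<xi> + z) / (\<xi> - z) - of_real c) / of_real r"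

text \<open>The inverse of \<open>to_half_plane\<close>, a Cayley transform precomposed with a real
  affine map.\<close>

definition of_half_plane :: "complex \<Rightarrow> real \<Rightarrow> real \<Rightarrow> complex \<Rightarrow> complex" where
  "of_half_plane \<xi> c r Z = \<xi> * (of_real r * Z + of_real c - \<i>) / (of_real r * Z + of_real c + \<i>)"

lemma cnj_ideal:
  assumes \<xi>: "norm \<xi> = 1"
  shows "cnj \<xi> = 1 / \<xi>"
  using \<xi> by (metis complex_div_cnj divide_inverse inverse_eq_divide mult_1 norm_one one_power2 div_by_1 of_real_1)

text \<open>Makes division by \<open>toward w \<xi>\<close> a rotation, which leaves moduli and
  hence distances unchanged.\<close>

lemma norm_toward_ideal:
  assumes \<xi>: "norm \<xi> = 1" and "norm w < 1"
  shows "norm (toward w \<xi>) = 1"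
proof -
  have x0: "\<xi> \<noteq> 0" using \<xi> by auto
  have "1 - cnj w * \<xi> = \<xi> * cnj (\<xi> - w)"
    using x0 by (simp add: cnj_ideal[OF \<xi>] algebra_simps)
  moreover have "\<xi> - w \<noteq> 0" using assms \<xi> by auto
  ultimately show ?thesis
    using \<xi> unfolding toward_def by (simp only: norm_divide norm_mult complex_mod_cnj) simp
qed

context
  fixes \<xi> :: complex and c r :: real
  assumes \<xi>: "norm \<xi> = 1" and r: "0 < r"
begin

lemma Im_to_half_plane:
  assumes "norm z < 1"
  shows "Im (to_half_plane \<xi> c r z) = (1 - (norm z)\<^sup>2) / (r * (norm (\<xi> - z))\<^sup>2)"
proof -
  have n: "\<xi> - z \<noteq> 0" using assms \<xi> by auto
  have "Im (\<i> * (\<xi> + z) / (\<xi> - z)) = ((norm \<xi>)\<^sup>2 - (norm z)\<^sup>2) / (norm (\<xi> - z))\<^sup>2"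
    unfolding Im_divide cmod_power2 by (simp add: algebra_simps power2_eq_square)
  then show ?thesis
    using r \<xi> by (simp add: to_half_plane_def Im_divide_of_real)
qed

lemma Im_to_half_plane_pos: "norm z < 1 \<Longrightarrow> 0 < Im (to_half_plane \<xi> c r z)"
  using \<xi> r by (auto simp: Im_to_half_plane abs_square_less_1 intro!: divide_pos_pos mult_pos_pos)

lemma of_half_plane_denom: "0 < Im Z \<Longrightarrow> of_real r * Z + of_real c + \<i> \<noteq> 0"
  using r by (auto simp: complex_eq_iff dest: mult_pos_pos[of r "Im Z"])

text \<open>This is the conformal factor of the disk metric in half-plane coordinates; with the
  derivative of \<open>of_half_plane\<close> it turns the area density into
  \<open>1 / (Im Z)^2\<close>.\<close>

lemma one_minus_norm_of_half_plane:
  assumes "0 < Im Z"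
  shows "1 - (norm (of_half_plane \<xi> c r Z))\<^sup>2
    = 4 * r * Im Z / (norm (of_real r * Z + of_real c + \<i>))\<^sup>2"
proof -
  let ?D = "of_real r * Z + of_real c + \<i>" and ?N = "of_real r * Z + of_real c - \<i>"
  have "(norm ?D)\<^sup>2 - (norm ?N)\<^sup>2 = 4 * r * Im Z"
    unfolding cmod_power2 by (simp add: algebra_simps power2_eq_square)
  moreover have "(norm ?D)\<^sup>2 \<noteq> 0"
    using of_half_plane_denom[OF assms] by simp
  moreover have eq: "norm (of_half_plane \<xi> c r Z) = norm ?N / norm ?D"
    using \<xi> by (simp only: of_half_plane_def norm_mult norm_divide mult_1)
  ultimately show ?thesis
    unfolding eq power_divide by (metis diff_divide_distrib divide_self)
qed

lemma norm_of_half_plane: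
  assumes "0 < Im Z" shows "norm (of_half_plane \<xi> c r Z) < 1"
proof -
  have "0 < 1 - (norm (of_half_plane \<xi> c r Z))\<^sup>2"
    unfolding one_minus_norm_of_half_plane[OF assms]
    using r assms of_half_plane_denom[OF assms] by simp
  then show ?thesis by (simp add: abs_square_less_1)
qed

lemma to_of_half_plane:
  assumes "0 < Im Z" shows "to_half_plane \<xi> c r (of_half_plane \<xi> c r Z) = Z"
proof -
  let ?u = "of_real r * Z + of_real c"
  have n: "?u + \<i> \<noteq> 0" using of_half_plane_denom[OF assms] .
  have x0: "\<xi> \<noteq> 0" using \<xi> by auto
  have "\<xi> + of_half_plane \<xi> c r Z = 2 * \<xi> * ?u / (?u + \<i>)"
    and "\<xi> - of_half_plane \<xi> c r Z = 2 * \<xi> * \<i> / (?u + \<i>)"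
    using n by (simp_all add: of_half_plane_def field_simps)
  then have "\<i> * (\<xi> + of_half_plane \<xi> c r Z) / (\<xi> - of_half_plane \<xi> c r Z)
      = \<i> * (2 * \<xi> * ?u / (?u + \<i>)) / (2 * \<xi> * \<i> / (?u + \<i>))"
    by simp
  also have "\<dots> = ?u"
    using n x0 by simp
  finally have "\<i> * (\<xi> + of_half_plane \<xi> c r Z) / (\<xi> - of_half_plane \<xi> c r Z) = ?u" .
  then show ?thesis using r by (simp add: to_half_plane_def)
qed

lemma of_to_half_plane:
  assumes "norm z < 1" shows "of_half_plane \<xi> c r (to_half_plane \<xi> c r z) = z"
proof -
  have n: "\<xi> - z \<noteq> 0" using assms \<xi> by auto
  have x0: "\<xi> \<noteq> 0" using \<xi> by auto
  have u: "of_real r * to_half_plane \<xi> c r z + of_real c = \<i> * (\<xi> + z) / (\<xi> - z)"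
    using r by (simp add: to_half_plane_def)
  have "\<i> * (\<xi> + z) / (\<xi> - z) + \<i> = 2 * \<i> * \<xi> / (\<xi> - z)"
    and "\<i> * (\<xi> + z) / (\<xi> - z) - \<i> = 2 * \<i> * z / (\<xi> - z)"
    using n by (simp_all add: field_simps)
  then have "of_half_plane \<xi> c r (to_half_plane \<xi> c r z)
      = \<xi> * (2 * \<i> * z / (\<xi> - z)) / (2 * \<i> * \<xi> / (\<xi> - z))"
    unfolding of_half_plane_def u by simp
  also have "\<dots> = z" using n x0 by simp
  finally show ?thesis .
qed

text \<open>Both sides are the isometry onto the disk that centres \<open>w\<close> and is rotated
  so that \<open>\<xi>\<close> goes to 1. Geodesics, angles and distances are all read off from this
  quotient.\<close>

lemma toward_quotient:
  assumes "norm w < 1" "norm z < 1"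
  defines "W \<equiv> to_half_plane \<xi> c r w" and "Z \<equiv> to_half_plane \<xi> c r z"
  shows "toward w z / toward w \<xi> = (Z - W) / (Z - cnj W)"
proof -
  have x0: "\<xi> \<noteq> 0" using \<xi> by auto
  have nz: "\<xi> - z \<noteq> 0" and nw: "\<xi> - w \<noteq> 0" using assms(1,2) \<xi> by auto
  have "1 - cnj w * \<xi> = \<xi> * cnj (\<xi> - w)"
    using x0 by (simp add: cnj_ideal[OF \<xi>] algebra_simps)
  then have nw': "1 - cnj w * \<xi> \<noteq> 0" using nw x0 by (simp del: complex_cnj_diff)
  have "norm (cnj w * z) < 1"
    using mult_strict_mono'[OF assms(1,2)] by (simp add: norm_mult)
  then have nwz: "1 - cnj w * z \<noteq> 0" by auto
  have r0: "of_real r \<noteq> (0::complex)" using r by simp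
  have "cnj (\<i> * (\<xi> + w) / (\<xi> - w)) = - \<i> * (1 + cnj w * \<xi>) / (1 - cnj w * \<xi>)"
    using x0 by (simp add: cnj_ideal[OF \<xi>] divide_simps algebra_simps)
  then have cW: "cnj W = (- \<i> * (1 + cnj w * \<xi>) / (1 - cnj w * \<xi>) - of_real c) / of_real r"
    by (simp add: W_def to_half_plane_def)
  have 1: "Z - W = \<i> * 2 * \<xi> * (z - w) / (of_real r * (\<xi> - z) * (\<xi> - w))"
    unfolding Z_def W_def to_half_plane_def using r0 nz nw by (simp add: divide_simps) (simp add: algebra_simps)
  have 2: "Z - cnj W = \<i> * 2 * \<xi> * (1 - cnj w * z) / (of_real r * (\<xi> - z) * (1 - cnj w * \<xi>))"
    unfolding cW unfolding Z_def to_half_plane_def using r0 nz nw' by (simp add: divide_simps) (simp add: algebra_simps)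
  show ?thesis
    unfolding 1 2 toward_def using r0 x0 nz nw nw' nwz by (simp add: divide_simps)
qed

text \<open>Horocycles centred at \<open>\<xi>\<close> become horizontal lines, so the Busemann
  function depends on the height alone.\<close>

lemma horocyclic_height:
  assumes "norm z < 1"
  shows "busemann \<xi> z = - ln (r * Im (to_half_plane \<xi> c r z))"
proof -
  have "\<xi> - z \<noteq> 0" using assms \<xi> by auto
  then show ?thesis
    using assms r unfolding busemann_def Im_to_half_plane[OF assms]
    by (subst ln_inverse[symmetric]) (auto simp: abs_square_less_1 divide_simps)
qed

end

section \<open>Points of the unit semicircle\<close>

text \<open>The parameter is the tangent of half the argument. Its logarithm is an arc length
  parameter of the geodesic formed by the upper semicircle.\<close>

definition circle_point :: "real \<Rightarrow> complex" where
  "circle_point a = cis (2 * arctan a)"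

lemma norm_circle_point [simp]: "norm (circle_point a) = 1"
  by (simp add: circle_point_def)

lemma Re_circle_point: "Re (circle_point a) = (1 - a\<^sup>2) / (1 + a\<^sup>2)"
  and Im_circle_point: "Im (circle_point a) = 2 * a / (1 + a\<^sup>2)"
  by (simp_all add: circle_point_def cos_two_arctan sin_two_arctan)

lemma Im_circle_point_pos: "0 < a \<Longrightarrow> 0 < Im (circle_point a)"
  by (simp add: Im_circle_point add_pos_nonneg)

lemma abs_Re_circle_point:
  assumes "0 < a"
  shows "\<bar>Re (circle_point a)\<bar> < 1"
proof -
  have "(Re (circle_point a))\<^sup>2 + (Im (circle_point a))\<^sup>2 = 1"
    by (simp add: cmod_power2[symmetric])
  then have "(Re (circle_point a))\<^sup>2 < 1"
    using Im_circle_point_pos[OF assms] by (smt (verit) zero_less_power)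
  then show ?thesis by (simp add: abs_square_less_1)
qed

lemma Re_circle_point_le_iff:
  assumes "0 < a" "0 < b"
  shows "Re (circle_point a) \<le> Re (circle_point b) \<longleftrightarrow> b \<le> a"
  using assms arctan_ubound[of a] arctan_ubound[of b]
  by (simp add: circle_point_def cos_mono_le_eq arctan_le_iff)

lemma circle_pointE:
  assumes "norm Z = 1" "0 < Im Z"
  obtains g where "0 < g" "Z = circle_point g"
proof
  have "(Re Z)\<^sup>2 + (Im Z)\<^sup>2 = 1" using assms(1) by (simp add: cmod_power2[symmetric])
  then have e: "(Im Z)\<^sup>2 = (1 - Re Z) * (1 + Re Z)" by (simp add: algebra_simps power2_eq_square)
  have "\<bar>Re Z\<bar> \<le> 1" using abs_Re_le_cmod[of Z] assms(1) by simp
  moreover have "Re Z \<noteq> -1" using e assms(2) by auto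
  ultimately have p: "0 < 1 + Re Z" by auto
  \<comment> \<open>The half-angle formula for the tangent, that is, stereographic projection from
    -1.\<close>
  define g where "g = Im Z / (1 + Re Z)"
  show "0 < Im Z / (1 + Re Z)" using p assms(2) by simp
  have g2: "g\<^sup>2 = (1 - Re Z) / (1 + Re Z)"
    using p e by (simp add: g_def power_divide power2_eq_square)
  have "1 + g\<^sup>2 = 2 / (1 + Re Z)" "1 - g\<^sup>2 = 2 * Re Z / (1 + Re Z)"
    using p by (simp_all add: g2 field_simps)
  then show "Z = circle_point (Im Z / (1 + Re Z))"
    using p unfolding g_def[symmetric]
    by (simp add: complex_eq_iff Re_circle_point Im_circle_point) (simp add: g_def)
qed

lemma circle_point_rational: "circle_point a = (1 + \<i> * a) / (1 - \<i> * a)"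
proof -
  have p: "1 + a\<^sup>2 \<noteq> 0" by (smt (verit) zero_le_power2)
  have n: "1 - \<i> * a \<noteq> 0" by (simp add: complex_eq_iff)
  have "circle_point a = Complex ((1 - a\<^sup>2) / (1 + a\<^sup>2)) (2 * a / (1 + a\<^sup>2))"
    by (simp add: complex_eq_iff Re_circle_point Im_circle_point)
  also have "\<dots> * (1 - \<i> * a) = 1 + \<i> * a"
    using p by (simp add: complex_eq_iff divide_simps) algebra
  finally show ?thesis using n by (simp add: field_simps)
qed

text \<open>Seen from the point with parameter \<open>a\<close>, all points of the semicircle lie on
  one line through the centre of the disk. The sign of \<open>g - a\<close> tells the side, and the
  modulus encodes the distance.\<close>

lemma circle_point_quotient:
  assumes "0 < a" "0 < g"
  shows "(circle_point g - circle_point a) / (circle_point g - cnj (circle_point a))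
    = circle_point a * of_real ((g - a) / (g + a))"
proof -
  have n: "1 - \<i> * complex_of_real x \<noteq> 0" "1 + \<i> * complex_of_real x \<noteq> 0" for x
    by (auto simp: complex_eq_iff)
  have s: "complex_of_real g + complex_of_real a \<noteq> 0"
    using assms by (metis add_pos_pos less_irrefl of_real_add of_real_eq_0_iff)
  have 1: "circle_point g - circle_point a = 2 * \<i> * (g - a) / ((1 - \<i> * g) * (1 - \<i> * a))"
    unfolding circle_point_rational using n by (simp add: divide_simps) (simp add: algebra_simps)
  have 2: "circle_point g - cnj (circle_point a) = 2 * \<i> * (g + a) / ((1 - \<i> * g) * (1 + \<i> * a))"
    unfolding circle_point_rational using n by (simp add: divide_simps) (simp add: algebra_simps)
  show ?thesis
    unfolding 1 2 unfolding circle_point_rational using n s by (simp add: divide_simps)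
qed

text \<open>The two cases are the two directions along the semicircle; they make supplementary
  angles with the vertical ray.\<close>

lemma Arg_circle_point:
  assumes "0 < a" "0 < t"
  shows "\<bar>Arg (circle_point a * of_real t)\<bar> = 2 * arctan a"
    and "\<bar>Arg (circle_point a * of_real (- t))\<bar> = pi - 2 * arctan a"
proof -
  have a: "0 < 2 * arctan a" "2 * arctan a < pi" using two_arctan_in[OF assms(1)] by auto
  have "Arg (circle_point a * of_real t) = 2 * arctan a"
  proof (rule cis_Arg_unique)
    show "sgn (circle_point a * of_real t) = cis (2 * arctan a)"
      using assms(2) by (simp add: circle_point_def sgn_mult sgn_of_real)
  qed (use a in linarith)+
  then show "\<bar>Arg (circle_point a * of_real t)\<bar> = 2 * arctan a" using a by simp
  have "circle_point a * of_real (- t) = of_real t * cis (2 * arctan a - pi)"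
    by (simp add: circle_point_def complex_eq_iff cos_diff sin_diff)
  moreover have "Arg \<dots> = 2 * arctan a - pi"
  proof (rule cis_Arg_unique)
    show "sgn (of_real t * cis (2 * arctan a - pi)) = cis (2 * arctan a - pi)"
      using assms(2) by (simp add: sgn_mult sgn_of_real)
  qed (use a in linarith)+
  ultimately show "\<bar>Arg (circle_point a * of_real (- t))\<bar> = pi - 2 * arctan a" using a by simp
qed

lemma two_artanh_quotient:
  fixes a b :: real
  assumes "0 < a" "a < b"
  shows "2 * artanh ((b - a) / (b + a)) = ln b - ln a"
proof -
  have "1 + (b - a) / (b + a) = 2 * b / (b + a)" "1 - (b - a) / (b + a) = 2 * a / (b + a)"
    using assms by (simp_all add: field_simps)
  then have "(1 + (b - a) / (b + a)) / (1 - (b - a) / (b + a)) = b / a"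
    using assms by simp
  then show ?thesis using assms by (simp add: artanh_def ln_div)
qed

section \<open>Geodesics and triangles in half-plane coordinates\<close>

context
  fixes \<xi> :: complex and c r :: real
  assumes \<xi>: "norm \<xi> = 1" and r: "0 < r"
begin

text \<open>With \<open>\<xi>\<close> at infinity the ray is a vertical half-line: the quotient from
  \<open>toward_quotient\<close> is real exactly when the real parts agree, and its value then fixes
  the height.\<close>

lemma geodesic_to_ideal:
  assumes w: "norm w < 1"
  shows "geodesic w \<xi> = {x. norm x < 1 \<and> Re (to_half_plane \<xi> c r x) = Re (to_half_plane \<xi> c r w)
    \<and> Im (to_half_plane \<xi> c r w) \<le> Im (to_half_plane \<xi> c r x)}"
proof -
  have "(\<exists>t. 0 \<le> t \<and> t \<le> 1 \<and> toward w x = complex_of_real t * toward w \<xi>) \<longleftrightarrow>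
      Re (to_half_plane \<xi> c r x) = Re (to_half_plane \<xi> c r w) \<and>
      Im (to_half_plane \<xi> c r w) \<le> Im (to_half_plane \<xi> c r x)" if x: "norm x < 1" for x
  proof -
    define X W where "X = to_half_plane \<xi> c r x" and "W = to_half_plane \<xi> c r w"
    have pos: "0 < Im X" "0 < Im W"
      using Im_to_half_plane_pos[OF \<xi> r] x w by (auto simp: X_def W_def)
    then have n: "X - cnj W \<noteq> 0" by (auto simp: complex_eq_iff)
    have n': "toward w \<xi> \<noteq> 0" using norm_toward_ideal[OF \<xi> w] by auto
    have "toward w x = (X - W) / (X - cnj W) * toward w \<xi>"
      using toward_quotient[OF \<xi> r w x, of c] n' by (simp add: X_def W_def nonzero_divide_eq_eq)
    then have "toward w x = complex_of_real t * toward w \<xi> \<longleftrightarrow> (X - W) / (X - cnj W) = of_real t" for t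
      using n' by (simp only: mult_cancel_right) simp
    then have "toward w x = complex_of_real t * toward w \<xi> \<longleftrightarrow>
        Re X - Re W = t * (Re X - Re W) \<and> Im X - Im W = t * (Im X + Im W)" for t
      using n by (simp add: nonzero_divide_eq_eq) (simp add: complex_eq_iff)
    then have "(\<exists>t. 0 \<le> t \<and> t \<le> 1 \<and> toward w x = complex_of_real t * toward w \<xi>) \<longleftrightarrow>
      (\<exists>t. 0 \<le> t \<and> t \<le> 1 \<and> Re X - Re W = t * (Re X - Re W) \<and> Im X - Im W = t * (Im X + Im W))"
      by simp
    also have "\<dots> \<longleftrightarrow> Re X = Re W \<and> Im W \<le> Im X"
    proof
      assume "Re X = Re W \<and> Im W \<le> Im X"
      then show "\<exists>t. 0 \<le> t \<and> t \<le> 1 \<and> Re X - Re W = t * (Re X - Re W) \<and> Im X - Im W = t * (Im X + Im W)"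
        using pos by (intro exI[of _ "(Im X - Im W) / (Im X + Im W)"]) (auto simp: field_simps)
    next
      assume "\<exists>t. 0 \<le> t \<and> t \<le> 1 \<and> Re X - Re W = t * (Re X - Re W) \<and> Im X - Im W = t * (Im X + Im W)"
      then obtain t where t: "0 \<le> t" "Re X - Re W = t * (Re X - Re W)"
        "Im X - Im W = t * (Im X + Im W)" by blast
      \<comment> \<open>\<open>t = 1\<close> is the ideal endpoint; it would force
        \<open>Im W = 0\<close>.\<close>
      have "t \<noteq> 1" using t(3) pos by auto
      moreover have "0 \<le> Im X - Im W" using t pos by simp
      ultimately show "Re X = Re W \<and> Im W \<le> Im X" using t(2) by simp
    qed
    finally show ?thesis by (simp add: X_def W_def)
  qed
  then show ?thesis unfolding geodesic_def by blast
qed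

text \<open>By \<open>circle_point_quotient\<close>, moving along the geodesic from \<open>w\<close>
  scales the real factor \<open>(g - a) / (g + a)\<close> from 0 to its value at \<open>b\<close>.
  This factor is monotone in \<open>g\<close>, so exactly the intermediate parameters occur.\<close>

lemma geodesic_on_circle:
  assumes w: "norm w < 1" and z: "norm z < 1"
    and a: "0 < a" and b: "0 < b" and ab: "a \<noteq> b"
    and W: "to_half_plane \<xi> c r w = circle_point a" and Z: "to_half_plane \<xi> c r z = circle_point b"
  shows "geodesic w z = {x. norm x < 1 \<and>
    (\<exists>g. min a b \<le> g \<and> g \<le> max a b \<and> to_half_plane \<xi> c r x = circle_point g)}"
proof -
  define q where "q = (b - a) / (b + a)"
  have q: "q \<noteq> 0" using a b ab by (simp add: q_def)
  have "(\<exists>t. 0 \<le> t \<and> t \<le> 1 \<and> toward w x = complex_of_real t * toward w z) \<longleftrightarrow>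
      (\<exists>g. min a b \<le> g \<and> g \<le> max a b \<and> to_half_plane \<xi> c r x = circle_point g)"
    if x: "norm x < 1" for x
  proof -
    define X where "X = to_half_plane \<xi> c r x"
    have ca: "circle_point a \<noteq> 0" by (metis norm_circle_point norm_zero zero_neq_one)
    have pos: "0 < Im X" "0 < Im (circle_point a)"
      using Im_to_half_plane_pos[OF \<xi> r] x Im_circle_point_pos[OF a] by (auto simp: X_def)
    then have n: "X - cnj (circle_point a) \<noteq> 0" by (auto simp: complex_eq_iff)
    have n': "toward w \<xi> \<noteq> 0" using norm_toward_ideal[OF \<xi> w] by auto
    have tz: "toward w z = circle_point a * of_real q * toward w \<xi>"
      using toward_quotient[OF \<xi> r w z, of c] circle_point_quotient[OF a b] n'
      by (simp add: W Z q_def nonzero_divide_eq_eq)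
    have tx: "toward w x = (X - circle_point a) / (X - cnj (circle_point a)) * toward w \<xi>"
      using toward_quotient[OF \<xi> r w x, of c] n' by (simp add: W X_def nonzero_divide_eq_eq)
    have iff: "toward w x = complex_of_real t * toward w z \<longleftrightarrow>
        (X - circle_point a) / (X - cnj (circle_point a)) = circle_point a * of_real (t * q)" for t
    proof -
      have "complex_of_real t * toward w z = circle_point a * of_real (t * q) * toward w \<xi>"
        by (simp add: tz)
      then show ?thesis unfolding tx using n' by (simp only: mult_cancel_right) simp
    qed
    \<comment> \<open>A Moebius map is injective, so the value of the quotient determines
      \<open>X\<close>. The cross-multiplied difference has the factor
      \<open>circle_point a - cnj (circle_point a)\<close>, nonzero off the real axis.\<close>
    have on_circle: "(X - circle_point a) / (X - cnj (circle_point a)) = circle_point a * of_real s \<longleftrightarrow>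
        X = circle_point g" if "0 < g" "s = (g - a) / (g + a)" for s g
    proof -
      have "Im (circle_point g) > 0" using that by (simp add: Im_circle_point_pos)
      then have "circle_point g - cnj (circle_point a) \<noteq> 0"
        using pos by (auto simp: complex_eq_iff)
      moreover have "circle_point a \<noteq> cnj (circle_point a)" using pos by (auto simp: complex_eq_iff)
      moreover have "(X - circle_point a) * (circle_point g - cnj (circle_point a)) -
          (circle_point g - circle_point a) * (X - cnj (circle_point a))
          = (X - circle_point g) * (circle_point a - cnj (circle_point a))"
        by (simp add: algebra_simps)
      ultimately have "(X - circle_point a) / (X - cnj (circle_point a)) =
          (circle_point g - circle_point a) / (circle_point g - cnj (circle_point a)) \<longleftrightarrow> X = circle_point g"
        using n by (metis eq_iff_diff_eq_0 frac_eq_eq mult_eq_0_iff)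
      then show ?thesis using circle_point_quotient[OF a that(1)] that(2) by simp
    qed
    show ?thesis
      unfolding iff X_def[symmetric]
    proof
      assume "\<exists>t. 0 \<le> t \<and> t \<le> 1 \<and>
        (X - circle_point a) / (X - cnj (circle_point a)) = circle_point a * of_real (t * q)"
      then obtain t where t: "0 \<le> t" "t \<le> 1"
        and eq: "(X - circle_point a) / (X - cnj (circle_point a)) = circle_point a * of_real (t * q)"
        by blast
      \<comment> \<open>Solving \<open>(g - a) / (g + a) = t * q\<close> gives
        \<open>g = a * (1 + t * q) / (1 - t * q)\<close>; \<open>e\<close> and \<open>d\<close> are
        numerator and denominator cleared of \<open>b + a\<close>.\<close>
      define d where "d = (1 + t) * a + (1 - t) * b"
      define e where "e = (1 + t) * b + (1 - t) * a"
      define g where "g = a * e / d"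
      have d: "0 < d" using t a b unfolding d_def by (intro add_pos_nonneg) auto
      have e: "0 < e" using t a b unfolding e_def by (intro add_pos_nonneg) auto
      have g: "0 < g" using a d e by (simp add: g_def)
      have "g - a = a * (e - d) / d" "g + a = a * (e + d) / d"
        using d by (simp_all add: g_def field_simps)
      then have "(g - a) / (g + a) = (e - d) / (e + d)" using a d by simp
      also have "e - d = 2 * t * (b - a)" by (simp add: e_def d_def algebra_simps)
      also have "e + d = 2 * (b + a)" by (simp add: e_def d_def algebra_simps)
      also have "2 * t * (b - a) / (2 * (b + a)) = t * q"
        unfolding q_def mult.assoc by (simp only: mult_divide_mult_cancel_left_if) simp
      finally have "t * q = (g - a) / (g + a)" by simp
      then have "X = circle_point g" using on_circle[OF g] eq by blast
      moreover have "min a b \<le> g \<and> g \<le> max a b"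
      proof -
        \<comment> \<open>In factored form both differences visibly have the sign of
          \<open>b - a\<close>, or vanish.\<close>
        have ga: "g - a = 2 * t * a * (b - a) / d" and gb: "b - g = (1 - t) * (b - a) * (b + a) / d"
          using d by (simp_all add: g_def field_simps) (simp_all add: d_def e_def algebra_simps)
        show ?thesis
        proof (cases "a < b")
          case True
          then have "0 \<le> g - a" "0 \<le> b - g" unfolding ga gb using t a b d by simp_all
          with True show ?thesis by auto
        next
          case False
          then have "2 * t * a * (b - a) \<le> 0" "(1 - t) * (b - a) * (b + a) \<le> 0"
            using t a b by (intro mult_nonneg_nonpos mult_nonpos_nonneg; simp)+
          then have "g - a \<le> 0" "b - g \<le> 0"
            unfolding ga gb using d by (intro divide_nonpos_pos; simp)+
          with False show ?thesis by auto
        qed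
      qed
      ultimately show "\<exists>g. min a b \<le> g \<and> g \<le> max a b \<and> X = circle_point g" by blast
    next
      assume "\<exists>g. min a b \<le> g \<and> g \<le> max a b \<and> X = circle_point g"
      then obtain g where g: "min a b \<le> g" "g \<le> max a b" "X = circle_point g" by blast
      then have g0: "0 < g" using a b by (auto simp: min_def split: if_splits)
      \<comment> \<open>The only possible value, since \<open>t * q\<close> must equal
        \<open>(g - a) / (g + a)\<close>.\<close>
      define t where "t = (g - a) / (g + a) / q"
      have t: "t = ((g - a) * (b + a)) / ((g + a) * (b - a))"
        by (simp add: t_def q_def)
      have "0 \<le> t \<and> t \<le> 1"
      proof (cases "a < b")
        case True
        with g have g': "a \<le> g" "g \<le> b" by auto
        have "g * a \<le> b * a" using g' a by simp
        then have "(g - a) * (b + a) \<le> (g + a) * (b - a)"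
          by (simp add: algebra_simps)
        with True g' a g0 show ?thesis by (simp add: t divide_le_eq_1)
      next
        case False
        with ab g have g': "b \<le> g" "g \<le> a" and lt: "b < a" by auto
        have t': "t = ((a - g) * (b + a)) / ((g + a) * (a - b))"
        proof -
          have "(g - a) * (b + a) = - ((a - g) * (b + a))" "(g + a) * (b - a) = - ((g + a) * (a - b))"
            by (simp_all add: algebra_simps)
          then show ?thesis unfolding t by (simp only: minus_divide_divide)
        qed
        have "b * a \<le> g * a" using g' a by simp
        then have "(a - g) * (b + a) \<le> (g + a) * (a - b)"
          by (simp add: algebra_simps)
        with lt g' a b g0 show ?thesis by (simp add: t' divide_le_eq_1)
      qed
      moreover have "t * q = (g - a) / (g + a)" using q by (simp add: t_def)
      ultimately show "\<exists>t. 0 \<le> t \<and> t \<le> 1 \<and>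
        (X - circle_point a) / (X - cnj (circle_point a)) = circle_point a * of_real (t * q)"
        using on_circle[OF g0] g(3) by metis
    qed
  qed
  then show ?thesis unfolding geodesic_def by blast
qed

text \<open>The triangle is swept out by vertical rays starting on the arc. Real parts decrease in
  the parameter, so the larger parameter gives the left edge.\<close>

lemma region_eq_half_plane_strip:
  assumes w: "norm w < 1" and z: "norm z < 1"
    and a: "0 < a" and b: "0 < b" and ab: "a \<noteq> b"
    and W: "to_half_plane \<xi> c r w = circle_point a" and Z: "to_half_plane \<xi> c r z = circle_point b"
  shows "region (Triangle w z \<xi>) = of_half_plane \<xi> c r `
    half_plane_strip (Re (circle_point (max a b))) (Re (circle_point (min a b)))"
    (is "_ = _ ` half_plane_strip ?u ?v")
proof -
  have mm: "0 < min a b" "0 < max a b" using a b by auto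
  have "x \<in> region (Triangle w z \<xi>) \<longleftrightarrow> norm x < 1 \<and> to_half_plane \<xi> c r x \<in> half_plane_strip ?u ?v" for x
  proof
    assume "x \<in> region (Triangle w z \<xi>)"
    then obtain y where y: "y \<in> geodesic w z" "x \<in> geodesic y \<xi>" by (auto simp: region_def)
    then obtain g where g: "norm y < 1" "min a b \<le> g" "g \<le> max a b"
        "to_half_plane \<xi> c r y = circle_point g"
      by (auto simp: geodesic_on_circle[OF assms])
    with y have x: "norm x < 1" "Re (to_half_plane \<xi> c r x) = Re (circle_point g)"
        "Im (circle_point g) \<le> Im (to_half_plane \<xi> c r x)"
      by (auto simp: geodesic_to_ideal)
    have g0: "0 < g" using g mm by linarith
    have "(Im (circle_point g))\<^sup>2 \<le> (Im (to_half_plane \<xi> c r x))\<^sup>2"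
      using x(3) Im_circle_point_pos[OF g0] by (intro power_mono) auto
    moreover have "(Re (circle_point g))\<^sup>2 + (Im (circle_point g))\<^sup>2 = 1"
      by (simp add: cmod_power2[symmetric])
    ultimately have "1 \<le> (Re (to_half_plane \<xi> c r x))\<^sup>2 + (Im (to_half_plane \<xi> c r x))\<^sup>2"
      using x(2) by simp
    then show "norm x < 1 \<and> to_half_plane \<xi> c r x \<in> half_plane_strip ?u ?v"
      using x g g0 mm Im_circle_point_pos[OF g0]
      by (auto simp: half_plane_strip_def Re_circle_point_le_iff)
  next
    assume x: "norm x < 1 \<and> to_half_plane \<xi> c r x \<in> half_plane_strip ?u ?v"
    define X where "X = to_half_plane \<xi> c r x"
    have X: "?u \<le> Re X" "Re X \<le> ?v" "0 < Im X" "1 \<le> (Re X)\<^sup>2 + (Im X)\<^sup>2"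
      using x by (auto simp: X_def half_plane_strip_def)
    have "\<bar>Re X\<bar> < 1"
      using X abs_Re_circle_point[OF mm(1)] abs_Re_circle_point[OF mm(2)] by linarith
    then have lt: "(Re X)\<^sup>2 < 1" by (simp add: abs_square_less_1)
    \<comment> \<open>The foot on the semicircle of the vertical ray through
      \<open>X\<close>.\<close>
    define Y where "Y = Complex (Re X) (sqrt (1 - (Re X)\<^sup>2))"
    have "norm Y = 1" "0 < Im Y" using lt by (simp_all add: Y_def cmod_def)
    then obtain g where g: "0 < g" "Y = circle_point g" by (rule circle_pointE)
    have "Im Y \<le> Im X"
      using X lt by (auto simp: Y_def intro!: real_le_lsqrt)
    moreover have "Re Y = Re X" by (simp add: Y_def)
    moreover have "min a b \<le> g" "g \<le> max a b"
      using X g mm Re_circle_point_le_iff[of g] Re_circle_point_le_iff[of _ g] \<open>Re Y = Re X\<close> by metis+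
    moreover define y where "y = of_half_plane \<xi> c r Y"
    moreover have "norm y < 1" "to_half_plane \<xi> c r y = Y"
      using norm_of_half_plane[OF \<xi> r] to_of_half_plane[OF \<xi> r] \<open>0 < Im Y\<close> by (auto simp: y_def)
    ultimately have "y \<in> geodesic w z" "x \<in> geodesic y \<xi>"
      using g x by (auto simp: geodesic_on_circle[OF assms] geodesic_to_ideal X_def)
    then show "x \<in> region (Triangle w z \<xi>)" by (auto simp: region_def)
  qed
  moreover have "norm x < 1 \<and> to_half_plane \<xi> c r x \<in> half_plane_strip ?u ?v \<longleftrightarrow>
      x \<in> of_half_plane \<xi> c r ` half_plane_strip ?u ?v" for x
    using norm_of_half_plane[OF \<xi> r] to_of_half_plane[OF \<xi> r] of_to_half_plane[OF \<xi> r]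
    by (auto simp: half_plane_strip_def image_iff)
  ultimately show ?thesis by blast
qed

end

section \<open>Triangles with one ideal vertex\<close>

text \<open>The isometry pulls the disk density back to the half-plane density, whose integral over
  the strip is known.\<close>

lemma hyp_area_image_half_plane_strip:
  assumes \<xi>: "norm \<xi> = 1" and r: "0 < r" and uv: "-1 < u" "u \<le> v" "v < 1"
    and borel: "of_half_plane \<xi> c r ` half_plane_strip u v \<in> sets borel"
  shows "hyp_area (of_half_plane \<xi> c r ` half_plane_strip u v) = arcsin v - arcsin u"
proof -
  let ?h = "of_half_plane \<xi> c r" and ?H = "half_plane_strip u v"
  let ?f = "\<lambda>z. 4 / (1 - (norm z)\<^sup>2)\<^sup>2 :: real"
  define h' where "h' Z = \<xi> * (2 * \<i> * of_real r) / (of_real r * Z + of_real c + \<i>)\<^sup>2" for Z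
  have hb: "?h \<in> borel_measurable borel" unfolding of_half_plane_def by measurable
  have h'b: "h' \<in> borel_measurable borel" unfolding h'_def by measurable
  have fb: "?f \<in> borel_measurable borel" by measurable
  have der: "(?h has_field_derivative h' Z) (at Z within ?H)" if "Z \<in> ?H" for Z
  proof -
    have "of_real r * Z + of_real c + \<i> \<noteq> 0"
      using that of_half_plane_denom[OF \<xi> r] by (simp add: half_plane_strip_def)
    then show ?thesis
      unfolding of_half_plane_def h'_def
      by (auto intro!: derivative_eq_intros simp: power2_eq_square divide_simps) (simp add: algebra_simps)
  qed
  have inj: "inj_on ?h ?H"
    using to_of_half_plane[OF \<xi> r] by (intro inj_on_inverseI[of _ "to_half_plane \<xi> c r"])
      (auto simp: half_plane_strip_def)
  have density: "(norm (h' Z))\<^sup>2 * ?f (?h Z) = 1 / (Im Z)\<^sup>2" if "Z \<in> ?H" for Z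
  proof -
    have Z: "0 < Im Z" using that by (simp add: half_plane_strip_def)
    define D where "D = norm (of_real r * Z + of_real c + \<i>)"
    have D: "D \<noteq> 0" using of_half_plane_denom[OF \<xi> r Z] by (simp add: D_def)
    have "norm (h' Z) = 2 * r / D\<^sup>2"
      using \<xi> r by (simp add: h'_def D_def norm_mult norm_divide norm_power)
    then show ?thesis
      unfolding one_minus_norm_of_half_plane[OF \<xi> r Z] D_def[symmetric]
      using D r Z by (simp add: field_simps power2_eq_square)
  qed
  have m: "(\<lambda>Z. (norm (h' Z))\<^sup>2 * ?f (?h Z)) \<in> borel_measurable borel"
    using hb h'b by measurable
  have int: "set_integrable lborel ?H (\<lambda>Z. (norm (h' Z))\<^sup>2 * ?f (?h Z))"
    using area_half_plane_strip(1)[OF uv] density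
    by (subst set_integrable_cong[OF refl refl density]) auto
  \<comment> \<open>On a Borel set with a Borel integrand, completing the measure does not change
    the integral.\<close>
  have "hyp_area (?h ` ?H) = (LINT z:?h ` ?H|lborel. ?f z)"
    unfolding hyp_area_def set_lebesgue_integral_def
    using borel fb by (intro integral_completion) simp
  also have "\<dots> = (LINT Z:?H|lborel. (norm (h' Z))\<^sup>2 * ?f (?h Z))"
    by (rule complex_change_of_variables[OF _ borel fb m der inj int]) measurable
  also have "\<dots> = (LINT Z:?H|lborel. 1 / (Im Z)\<^sup>2)"
    using density by (intro set_lebesgue_integral_cong) auto
  finally show ?thesis using area_half_plane_strip(2)[OF uv] by simp
qed

text \<open>The image is rewritten as a preimage under the inverse map, cut down to the disk, since
  preimages under Borel maps are Borel.\<close>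

lemma image_half_plane_strip_borel:
  assumes \<xi>: "norm \<xi> = 1" and r: "0 < r"
  shows "of_half_plane \<xi> c r ` half_plane_strip u v \<in> sets borel"
proof -
  have "x \<in> of_half_plane \<xi> c r ` half_plane_strip u v \<longleftrightarrow>
      x \<in> ball 0 1 \<inter> to_half_plane \<xi> c r -` half_plane_strip u v" for x
    using norm_of_half_plane[OF \<xi> r] to_of_half_plane[OF \<xi> r] of_to_half_plane[OF \<xi> r]
    by (auto simp: half_plane_strip_def image_iff)
  then have eq: "of_half_plane \<xi> c r ` half_plane_strip u v =
      ball 0 1 \<inter> to_half_plane \<xi> c r -` half_plane_strip u v" by blast
  have "to_half_plane \<xi> c r \<in> borel_measurable borel" unfolding to_half_plane_def by measurable
  from measurable_sets[OF this half_plane_strip_borel] show ?thesis unfolding eq by auto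
qed

text \<open>Since the vertices are not on a common geodesic, the finite vertices lie on a semicircle
  centred on the real axis; translating and scaling makes it the unit one.\<close>

lemma cusp_triangle_half_plane:
  assumes "cusp_triangle (Triangle w z \<xi>)"
  obtains c r a b where "0 < r" "0 < a" "0 < b" "a \<noteq> b"
    "to_half_plane \<xi> c r w = circle_point a" "to_half_plane \<xi> c r z = circle_point b"
proof -
  have w: "norm w < 1" and z: "norm z < 1" and \<xi>: "norm \<xi> = 1"
    and nr: "toward w z / toward w \<xi> \<notin> \<real>"
    using assms by (auto simp: cusp_triangle_def)
  define W Z where "W = to_half_plane \<xi> 0 1 w" and "Z = to_half_plane \<xi> 0 1 z"
  have pos: "0 < Im W" "0 < Im Z"
    using Im_to_half_plane_pos[OF \<xi> zero_less_one] w z by (auto simp: W_def Z_def)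
  \<comment> \<open>Otherwise both finite vertices would lie on one vertical geodesic ending at
    \<open>\<xi>\<close>.\<close>
  have ne: "Re Z \<noteq> Re W"
  proof
    assume "Re Z = Re W"
    then have "Z - W = \<i> * of_real (Im Z - Im W)" "Z - cnj W = \<i> * of_real (Im Z + Im W)"
      by (simp_all add: complex_eq_iff)
    then have "(Z - W) / (Z - cnj W) = of_real ((Im Z - Im W) / (Im Z + Im W))" by simp
    then have "toward w z / toward w \<xi> \<in> \<real>"
      using toward_quotient[OF \<xi> zero_less_one w z, of 0] by (metis W_def Z_def Reals_of_real)
    with nr show False by simp
  qed
  \<comment> \<open>The real point equidistant from \<open>W\<close> and \<open>Z\<close>, where
    their perpendicular bisector meets the real axis.\<close>
  define c where "c = ((norm Z)\<^sup>2 - (norm W)\<^sup>2) / (2 * (Re Z - Re W))"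
  define r where "r = norm (W - of_real c)"
  have "2 * c * (Re Z - Re W) = (norm Z)\<^sup>2 - (norm W)\<^sup>2" 
  proof -
    have *: "2 * (N / (2 * x)) * x = N" if "x \<noteq> 0" for x N :: real using that by simp
    show ?thesis unfolding c_def by (rule *) (use ne in simp)
  qed
  then have "(norm (Z - of_real c))\<^sup>2 = (norm (W - of_real c))\<^sup>2"
    unfolding cmod_power2 by (simp add: power2_eq_square algebra_simps)
  then have rZ: "norm (Z - of_real c) = r" by (simp add: r_def)
  have rW: "norm (W - of_real c) = r" by (simp add: r_def)
  have "W - of_real c \<noteq> 0" using pos by (auto simp: complex_eq_iff)
  then have r: "0 < r" by (simp add: r_def)
  have t: "to_half_plane \<xi> c r w = (W - of_real c) / of_real r" "to_half_plane \<xi> c r z = (Z - of_real c) / of_real r"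
    by (simp_all add: to_half_plane_def W_def Z_def)
  have "norm (to_half_plane \<xi> c r w) = 1" "norm (to_half_plane \<xi> c r z) = 1"
    using r rZ rW by (simp_all add: t norm_divide)
  then obtain a b where ab: "0 < a" "0 < b"
    "to_half_plane \<xi> c r w = circle_point a" "to_half_plane \<xi> c r z = circle_point b"
    using circle_pointE Im_to_half_plane_pos[OF \<xi> r] w z by metis
  moreover have "a \<noteq> b"
  proof
    assume "a = b"
    with ab(3,4) have "(W - of_real c) / of_real r = (Z - of_real c) / of_real r"
      unfolding t by simp
    with r have "W = Z" by simp
    with ne show False by simp
  qed
  ultimately show ?thesis using that r by blast
qed

lemma toward_on_circle:
  assumes \<xi>: "norm \<xi> = 1" and r: "0 < r" and w: "norm w < 1" and z: "norm z < 1"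
    and a: "0 < a" and b: "0 < b"
    and W: "to_half_plane \<xi> c r w = circle_point a" and Z: "to_half_plane \<xi> c r z = circle_point b"
  shows "toward w z / toward w \<xi> = circle_point a * of_real ((b - a) / (b + a))"
  using toward_quotient[OF \<xi> r w z, of c] circle_point_quotient[OF a b] by (simp add: W Z)

lemma hyp_angle_on_circle:
  assumes "norm \<xi> = 1" "0 < r" "norm w < 1" "norm z < 1" "0 < a" "0 < b"
    "to_half_plane \<xi> c r w = circle_point a" "to_half_plane \<xi> c r z = circle_point b"
  shows "a < b \<Longrightarrow> hyp_angle z w \<xi> = 2 * arctan a"
    and "b < a \<Longrightarrow> hyp_angle z w \<xi> = pi - 2 * arctan a"
proof -
  have eq: "hyp_angle z w \<xi> = \<bar>Arg (circle_point a * of_real ((b - a) / (b + a)))\<bar>"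
    unfolding hyp_angle_def toward_on_circle[OF assms] ..
  show "hyp_angle z w \<xi> = 2 * arctan a" if "a < b"
    unfolding eq using that assms(5,6) by (intro Arg_circle_point) auto
  have m: "(b - a) / (b + a) = - ((a - b) / (b + a))"
    by (simp add: minus_divide_left)
  show "hyp_angle z w \<xi> = pi - 2 * arctan a" if "b < a"
    unfolding eq m using that assms(5,6) by (intro Arg_circle_point) auto
qed

lemma hyp_dist_on_circle:
  assumes \<xi>: "norm \<xi> = 1" and "0 < r" and w: "norm w < 1" and "norm z < 1" "0 < a" "0 < b"
    "to_half_plane \<xi> c r w = circle_point a" "to_half_plane \<xi> c r z = circle_point b"
  shows "hyp_dist w z = \<bar>ln b - ln a\<bar>"
proof -
  have "norm (toward w z) = norm (toward w z / toward w \<xi>)"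
    using norm_toward_ideal[OF \<xi> w] by (simp add: norm_divide)
  also have "\<dots> = \<bar>(b - a) / (b + a)\<bar>"
    unfolding toward_on_circle[OF assms] norm_mult norm_of_real by simp
  finally have n: "norm (toward w z) = \<bar>b - a\<bar> / (b + a)" using assms(5,6) by (simp add: abs_divide)
  consider "a < b" | "b < a" | "a = b" by linarith
  then show ?thesis
  proof cases
    case 1 then show ?thesis
      using n two_artanh_quotient[of a b] assms(5,6) by (simp add: hyp_dist_def)
  next
    case 2 then show ?thesis
      using n two_artanh_quotient[of b a] assms(5,6) by (simp add: hyp_dist_def add.commute)
  next
    case 3 then show ?thesis using n by (simp add: hyp_dist_def)
  qed
qed

lemma arctan_inverse_pos: "0 < x \<Longrightarrow> arctan (1 / x) = pi / 2 - arctan x"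
  using arctan_inverse[of x] by (simp add: sgn_if inverse_eq_divide)

text \<open>The reflection \<open>Z \<mapsto> - cnj Z\<close>, which inverts both parameters, gives \<open>a < b\<close>.\<close>

lemma cusp_triangle_parameters:
  assumes "cusp_triangle T"
  obtains a b where "0 < a" "a < b" "finite_side_length T = ln b - ln a"
    "fst_angle T = 2 * arctan a" "snd_angle T = pi - 2 * arctan b"
    "hyp_area (region T) = 2 * arctan b - 2 * arctan a"
    "horocyclic_shift T = ln (sin (2 * arctan a)) - ln (sin (2 * arctan b))"
proof -
  obtain w z \<xi> where T: "T = Triangle w z \<xi>" by (cases T)
  have w: "norm w < 1" and z: "norm z < 1" and \<xi>: "norm \<xi> = 1"
    using assms by (auto simp: cusp_triangle_def T)
  obtain c r a b where r: "0 < r" and a: "0 < a" and b: "0 < b" and ab: "a \<noteq> b"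
    and W: "to_half_plane \<xi> c r w = circle_point a" and Z: "to_half_plane \<xi> c r z = circle_point b"
    using cusp_triangle_half_plane assms unfolding T by metis
  note hyps = \<xi> r w z a b W Z and hyps' = \<xi> r z w b a Z W
  have len: "finite_side_length T = \<bar>ln b - ln a\<bar>"
    using hyp_dist_on_circle[OF hyps] by (simp add: T finite_side_length_def)
  have shift: "horocyclic_shift T = ln (sin (2 * arctan a)) - ln (sin (2 * arctan b))"
    using Im_circle_point_pos[OF a] Im_circle_point_pos[OF b] r
    unfolding horocyclic_shift_def T triangle.sel horocyclic_height[OF \<xi> r w, of c] horocyclic_height[OF \<xi> r z, of c] W Z
    by (simp add: ln_mult circle_point_def)
  \<comment> \<open>Converts the strip area into the parameters; the minus sign matches the reversed
    order of the real parts.\<close>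
  have arcsin_Re: "arcsin (Re (circle_point g)) = pi / 2 - 2 * arctan g" if "0 < g" for g
  proof -
    have "Re (circle_point g) = sin (pi / 2 - 2 * arctan g)"
      by (simp add: circle_point_def cos_sin_eq)
    then show ?thesis using two_arctan_in[OF that] by (simp add: arcsin_sin)
  qed
  have Re_bounds: "-1 < Re (circle_point g)" "Re (circle_point g) < 1" if "0 < g" for g
    using abs_Re_circle_point[OF that] by linarith+
  have area: "hyp_area (region T) = 2 * arctan (max a b) - 2 * arctan (min a b)"
  proof -
    have mm: "0 < min a b" "0 < max a b" using a b by auto
    then show ?thesis
      unfolding T region_eq_half_plane_strip[OF \<xi> r w z a b ab W Z]
      using arcsin_Re Re_bounds
      by (subst hyp_area_image_half_plane_strip[OF \<xi> r _ _ _ image_half_plane_strip_borel[OF \<xi> r]])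
        (auto simp: Re_circle_point_le_iff a b)
  qed
  have fst: "fst_angle T = hyp_angle z w \<xi>" and snd: "snd_angle T = hyp_angle w z \<xi>"
    by (simp_all add: T fst_angle_def snd_angle_def)
  show ?thesis
  proof (cases "a < b")
    case True
    then have "ln a < ln b" using a by simp
    then show ?thesis
      using that[of a b] True a len shift area
        hyp_angle_on_circle(1)[OF hyps True] hyp_angle_on_circle(2)[OF hyps' True] fst snd by simp
  next
    case False
    with ab have lt: "b < a" by simp
    then have "ln b < ln a" using b by simp
    \<comment> \<open>Inverting a parameter replaces its argument by the supplement and keeps the
      height.\<close>
    moreover have "sin (2 * arctan (1 / x)) = sin (2 * arctan x)" if "0 < x" for x :: real
      using that by (simp add: arctan_inverse_pos right_diff_distrib)
    ultimately show ?thesis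
      using that[of "1 / a" "1 / b"] lt a b len shift area fst snd
        hyp_angle_on_circle(2)[OF hyps lt] hyp_angle_on_circle(1)[OF hyps' lt]
      by (simp add: arctan_inverse_pos ln_div frac_less2)
  qed
qed

section \<open>Polygonal cusps\<close>

text \<open>
  The area of the isosceles triangle with finite side \<open>L\<close>, that is, twice the Gudermannian of \<open>L / 2\<close>.
\<close>

definition max_triangle_area :: "real \<Rightarrow> real" where
  "max_triangle_area L = 2 * arctan (sinh (L / 2))"

section \<open>Area bound for a given perimeter\<close>

lemma arctan_difference_le:
  assumes "0 < a" "a < b"
  shows "2 * arctan b - 2 * arctan a \<le> max_triangle_area (ln b - ln a)"
proof -
  \<comment> \<open>Square roots make the exponential of half the side length the quotient
    \<open>v / u\<close>, and AM-GM becomes \<open>0 \<le> (u * v - 1)^2\<close>.\<close>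
  define u v where "u = sqrt a" and "v = sqrt b"
  have uv: "0 < u" "u < v" "a = u\<^sup>2" "b = v\<^sup>2" using assms by (auto simp: u_def v_def)
  define s where "s = (ln b - ln a) / 2"
  have "ln a = 2 * ln u" "ln b = 2 * ln v" using uv by (simp_all add: ln_realpow)
  then have "s = ln v - ln u" by (simp add: s_def)
  then have "exp s = v / u" using uv by (simp add: exp_diff)
  then have sinh: "sinh s = (v / u - u / v) / 2" by (simp add: sinh_def exp_minus)
  have "(b - a) / (1 + a * b) \<le> sinh s"
  proof -
    have "2 * (u * v) \<le> 1 + a * b"
      using zero_le_power2[of "u * v - 1"] by (simp add: uv power2_eq_square algebra_simps)
    then have "(b - a) / (1 + a * b) \<le> (b - a) / (2 * (u * v))"
      using assms uv by (intro divide_left_mono) (auto intro!: mult_pos_pos add_pos_pos)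
    also have "\<dots> = sinh s"
      unfolding sinh using uv by (simp add: field_simps power2_eq_square)
    finally show ?thesis .
  qed
  then have "arctan ((b - a) / (1 + a * b)) \<le> arctan (sinh s)" by (rule arctan_monotone')
  \<comment> \<open>Both angles lie between 0 and \<open>pi / 2\<close>, so their difference stays
    on the principal branch.\<close>
  moreover have "arctan b - arctan a = arctan ((b - a) / (1 + a * b))"
  proof (rule arctan_unique[symmetric])
    have ba: "0 < arctan a" "arctan a < arctan b" "arctan b < pi / 2"
      using assms arctan_ubound by (auto simp: arctan_less_iff)
    then show "- (pi / 2) < arctan b - arctan a" "arctan b - arctan a < pi / 2" by linarith+
    have "cos (arctan b - arctan a) > 0" using ba by (intro cos_gt_zero_pi) linarith+
    then show "tan (arctan b - arctan a) = (b - a) / (1 + a * b)"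
      by (subst tan_diff) (auto simp: tan_arctan mult.commute)
  qed
  ultimately show ?thesis
    unfolding max_triangle_area_def s_def by linarith
qed

text \<open>The equality case of AM-GM: the triangle is symmetric about the imaginary axis.\<close>

lemma max_triangle_area_attained:
  assumes "0 < a" "a < b" "a * b = 1"
  shows "2 * arctan b - 2 * arctan a = max_triangle_area (ln b - ln a)"
proof -
  have b: "b = 1 / a" using assms by (simp add: field_simps)
  have "(ln b - ln a) / 2 = - ln a" using assms(1) by (simp add: b ln_div)
  then have "sinh ((ln b - ln a) / 2) = sinh (- ln a)" by (rule arg_cong)
  also have "\<dots> = (1 / a - a) / 2"
    using assms(1) by (simp add: sinh_ln_real field_simps)
  finally have sinh: "sinh ((ln b - ln a) / 2) = (1 / a - a) / 2" .
  have "arctan b - arctan a = arctan ((1 / a - a) / 2)"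
  proof (rule arctan_unique[symmetric])
    have ba: "0 < arctan a" "arctan a < arctan b" "arctan b < pi / 2"
      using assms arctan_ubound by (auto simp: arctan_less_iff)
    then show "- (pi / 2) < arctan b - arctan a" "arctan b - arctan a < pi / 2" by linarith+
    have "cos (arctan b - arctan a) > 0" using ba by (intro cos_gt_zero_pi) linarith+
    then show "tan (arctan b - arctan a) = (1 / a - a) / 2"
      using assms(1) by (subst tan_diff) (auto simp: tan_arctan b)
  qed
  then show ?thesis unfolding max_triangle_area_def sinh by linarith
qed

text \<open>Concavity in tangent-line form: the derivative \<open>1 / cosh (t / 2)\<close> decreases
  for nonnegative \<open>t\<close>.\<close>

lemma max_triangle_area_le_tangent:
  assumes "0 \<le> x" "0 \<le> y"
  shows "max_triangle_area y \<le> max_triangle_area x + (y - x) / cosh (x / 2)"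
proof -
  have d: "(max_triangle_area has_real_derivative 1 / cosh (t / 2)) (at t)" for t
  proof -
    have "1 + (sinh (t / 2))\<^sup>2 = (cosh (t / 2))\<^sup>2" by (simp add: cosh_square_eq)
    then show ?thesis
      unfolding max_triangle_area_def[abs_def]
      by (auto intro!: derivative_eq_intros simp: field_simps power2_eq_square)
  qed
  consider "x < y" | "y < x" | "x = y" by linarith
  then show ?thesis
  proof cases
    case 1
    then obtain t where t: "x < t" "t < y"
      "max_triangle_area y - max_triangle_area x = (y - x) * (1 / cosh (t / 2))"
      using MVT2[OF 1 d] by blast
    have "cosh (x / 2) \<le> cosh (t / 2)"
      using t assms by (subst cosh_real_nonneg_le_iff) auto
    then have "(y - x) / cosh (t / 2) \<le> (y - x) / cosh (x / 2)"
      using 1 by (intro divide_left_mono) (auto simp: cosh_real_pos)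
    with t show ?thesis by simp
  next
    case 2
    then obtain t where t: "y < t" "t < x"
      "max_triangle_area x - max_triangle_area y = (x - y) * (1 / cosh (t / 2))"
      using MVT2[OF 2 d] by blast
    have "cosh (t / 2) \<le> cosh (x / 2)"
      using t assms by (subst cosh_real_nonneg_le_iff) auto
    then have "(x - y) / cosh (x / 2) \<le> (x - y) / cosh (t / 2)"
      using 2 by (intro divide_left_mono) (auto simp: cosh_real_pos)
    moreover have "(y - x) / cosh (x / 2) = - ((x - y) / cosh (x / 2))"
      by (metis minus_diff_eq minus_divide_left)
    ultimately show ?thesis using t by simp
  qed simp
qed

text \<open>Jensen's inequality: each triangle is bounded by the tangent line at the mean side
  length, and the linear terms cancel in the sum.\<close>

lemma cusp_area_le:
  assumes "polygonal_cusp p C"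
  shows "cusp_area C \<le> p * max_triangle_area (perimeter C / p)"
proof -
  have p: "1 \<le> p" "length C = p" "\<And>i. i < p \<Longrightarrow> cusp_triangle (C ! i)"
    using assms by (auto simp: polygonal_cusp_def)
  define m where "m = perimeter C / p"
  have le: "0 \<le> side_length C i \<and> hyp_area (region (C ! i)) \<le> max_triangle_area (side_length C i)"
    if i: "i < p" for i
  proof -
    obtain a b where ab: "0 < a" "a < b" "finite_side_length (C ! i) = ln b - ln a"
      "hyp_area (region (C ! i)) = 2 * arctan b - 2 * arctan a"
      using cusp_triangle_parameters[OF p(3)[OF i]] by metis
    then have "ln a < ln b" by simp
    then show ?thesis using ab arctan_difference_le[OF ab(1,2)] by (simp add: side_length_def)
  qed
  have sum: "(\<Sum>i<p. side_length C i) = p * m" using p by (simp add: m_def perimeter_def)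
  have m: "0 \<le> m"
    unfolding m_def perimeter_def using le p by (intro divide_nonneg_nonneg sum_nonneg) auto
  have "cusp_area C \<le> (\<Sum>i<p. max_triangle_area m + (side_length C i - m) / cosh (m / 2))"
    unfolding cusp_area_def p(2)
    using le max_triangle_area_le_tangent[OF m] by (intro sum_mono) (meson lessThan_iff order_trans)
  also have "\<dots> = p * max_triangle_area m + ((\<Sum>i<p. side_length C i) - p * m) / cosh (m / 2)"
    by (simp add: sum.distrib sum_subtractf flip: sum_divide_distrib)
  also have "\<dots> = p * max_triangle_area m" by (simp add: sum)
  finally show ?thesis by (simp add: m_def)
qed

section \<open>Rigidity of regular cusps\<close>

text \<open>A first strict step in either direction is propagated by monotonicity, so the sequence
  cannot return to its value after \<open>p\<close> steps.\<close>

lemma increasing_recurrence_periodic_const: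
  fixes x :: "nat \<Rightarrow> 'a::linorder"
  assumes mono: "\<And>n m. x n < x m \<Longrightarrow> x (Suc n) < x (Suc m)"
    and per: "\<And>n. x (n + p) = x n" and p: "0 < p"
  shows "x n = x (Suc n)"
proof (rule ccontr)
  assume ne: "x n \<noteq> x (Suc n)"
  have up: "x (n + k) < x (Suc (n + k))" if "x n < x (Suc n)" for k
    using that mono by (induction k) auto
  have down: "x (Suc (n + k)) < x (n + k)" if "x (Suc n) < x n" for k
    using that mono by (induction k) auto
  show False
  proof (cases "x n < x (Suc n)")
    case True
    have "x n < x (n + Suc k)" for k
    proof (induction k)
      case (Suc k)
      then show ?case using up[OF True, of "Suc k"] by simp
    qed (use True in simp)
    from this[of "p - 1"] show False using per[of n] p by simp
  next
    case False
    with ne have lt: "x (Suc n) < x n" by simp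
    have "x (n + Suc k) < x n" for k
    proof (induction k)
      case (Suc k)
      then show ?case using down[OF lt, of "Suc k"] by simp
    qed (use lt in simp)
    from this[of "p - 1"] show False using per[of n] p by simp
  qed
qed

text \<open>For \<open>a * b = 1\<close> the angles at the two finite vertices are both
  \<open>2 * arctan a\<close>, so this is the interior angle of the regular cusp. Here
  \<open>a < 1\<close> keeps \<open>2 * arctan a\<close> below \<open>pi / 2\<close>, where
  \<open>arcsin\<close> inverts \<open>sin\<close>.\<close>

lemma two_arcsin_sech:
  assumes "0 < a" "a < b" "a * b = 1"
  shows "2 * arcsin (sech ((ln b - ln a) / 2)) = 4 * arctan a"
proof -
  have b: "b = 1 / a" using assms by (simp add: field_simps)
  have "a * a < 1" using assms mult_strict_left_mono[of a b a] by simp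
  then have a1: "a < 1" using assms(1) by (metis less_1_mult linorder_neqE_linordered_idom mult_1 order_less_asym)
  have "(ln b - ln a) / 2 = - ln a" using assms(1) by (simp add: b ln_div)
  then have "cosh ((ln b - ln a) / 2) = cosh (- ln a)" by (rule arg_cong)
  also have "\<dots> = (1 / a + a) / 2"
    using assms(1) by (simp add: cosh_ln_real field_simps)
  also have "\<dots> = (1 + a\<^sup>2) / (2 * a)"
    using assms(1) by (simp add: field_simps power2_eq_square)
  finally have "sech ((ln b - ln a) / 2) = sin (2 * arctan a)"
    by (simp add: sech_def sin_two_arctan)
  moreover have "arcsin (sin (2 * arctan a)) = 2 * arctan a"
  proof -
    have "0 < arctan a" "arctan a < pi / 4"
      using a1 assms(1) arctan_less_iff[of a 1] by (simp_all add: arctan_one)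
    then show ?thesis by (intro arcsin_sin) linarith+
  qed
  ultimately show ?thesis by simp
qed

text \<open>Determines the angle and area of every complete regular cusp from its perimeter; the
  area equals the bound of \<open>cusp_area_le\<close>.\<close>

lemma regular_cusp_rigidity:
  assumes R: "polygonal_cusp p R" "complete_at_puncture R" "regular_cusp R"
  shows "\<forall>i<p. interior_angle R i = 2 * arcsin (sech (perimeter R / (2 * real p)))"
    and "cusp_area R = p * max_triangle_area (perimeter R / p)"
proof -
  have p: "1 \<le> p" "length R = p" "\<And>i. i < p \<Longrightarrow> cusp_triangle (R ! i)"
    using R by (auto simp: polygonal_cusp_def)
  have "\<exists>a b. 0 < a \<and> a < b \<and> finite_side_length (R ! i) = ln b - ln a \<and>
    fst_angle (R ! i) = 2 * arctan a \<and> snd_angle (R ! i) = pi - 2 * arctan b \<and>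
    hyp_area (region (R ! i)) = 2 * arctan b - 2 * arctan a \<and>
    horocyclic_shift (R ! i) = ln (sin (2 * arctan a)) - ln (sin (2 * arctan b))" if "i < p" for i
    using cusp_triangle_parameters[OF p(3)[OF that]] by metis
  then obtain a b where ab: "\<And>i. i < p \<Longrightarrow> 0 < a i \<and> a i < b i \<and>
    finite_side_length (R ! i) = ln (b i) - ln (a i) \<and>
    fst_angle (R ! i) = 2 * arctan (a i) \<and> snd_angle (R ! i) = pi - 2 * arctan (b i) \<and>
    hyp_area (region (R ! i)) = 2 * arctan (b i) - 2 * arctan (a i) \<and>
    horocyclic_shift (R ! i) = ln (sin (2 * arctan (a i))) - ln (sin (2 * arctan (b i)))"
    by metis
  have eqL: "side_length R i = side_length R 0" if "i < p" for i
    using R(3) p that unfolding regular_cusp_def by (metis One_nat_def Suc_le_lessD)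
  have eqA: "interior_angle R i = interior_angle R 0" if "i < p" for i
    using R(3) p that unfolding regular_cusp_def by (metis One_nat_def Suc_le_lessD)
  define L where "L = side_length R 0"
  have L: "L = perimeter R / p"
  proof -
    have "(\<Sum>i<p. side_length R i) = (\<Sum>i<p. L)"
      unfolding L_def by (intro sum.cong refl eqL) simp
    with p show ?thesis by (simp add: perimeter_def)
  qed
  have b: "b i = exp L * a i" if "i < p" for i
  proof -
    have "ln (b i) - ln (a i) = L" using eqL[OF that] ab[OF that] by (simp add: side_length_def L_def)
    then have "ln (b i) = L + ln (a i)" by simp
    then show ?thesis using ab[OF that] by (metis exp_add exp_ln less_trans)
  qed
  \<comment> \<open>Unrolling the cyclic order gives a periodic sequence on all natural
    numbers.\<close>
  define x where "x n = a (n mod p)" for n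
  have step: "x (Suc n) = x n" for n
  proof (rule increasing_recurrence_periodic_const[symmetric, of x p])
    fix n m assume lt: "x n < x m"
    \<comment> \<open>The vertex between triangles \<open>n\<close> and \<open>n + 1\<close> yields
      the recurrence: its fixed angle makes the next parameter an increasing function of the current
      one.\<close>
    have angle: "pi - 2 * arctan (exp L * x n) + 2 * arctan (x (Suc n)) = interior_angle R 0" for n
    proof -
      define i where "i = Suc n mod p"
      have i: "i < p" using p by (simp add: i_def)
      \<comment> \<open>The cyclic predecessor of \<open>i\<close>; for \<open>p = 1\<close> the
        triangle precedes itself.\<close>
      have "(i + p - 1) mod p = n mod p"
      proof -
        have "(i + p - 1) mod p = (i + (p - 1)) mod p" using p by simp
        also have "\<dots> = (Suc n + (p - 1)) mod p" by (simp add: i_def mod_add_left_eq)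
        also have "Suc n + (p - 1) = n + p" using p by simp
        finally show ?thesis by simp
      qed
      then have "interior_angle R i = snd_angle (R ! (n mod p)) + fst_angle (R ! i)"
        by (simp add: interior_angle_def p)
      moreover have "n mod p < p" using p by simp
      ultimately show ?thesis
        using ab[of "n mod p"] ab[OF i] b[of "n mod p"] eqA[OF i] by (simp add: x_def i_def)
    qed
    have "arctan (exp L * x n) < arctan (exp L * x m)" using lt by (simp add: arctan_less_iff)
    then have "arctan (x (Suc n)) < arctan (x (Suc m))" using angle[of n] angle[of m] by simp
    then show "x (Suc n) < x (Suc m)" by (simp add: arctan_less_iff)
  qed (use p in \<open>auto simp: x_def\<close>)
  have "x n = x 0" for n by (induction n) (simp_all add: step)
  then have a: "a i = a 0" if "i < p" for i using that by (metis x_def mod_0 mod_less)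
  have 0: "0 < p" using p by simp
  note ab0 = ab[OF 0]
  have shift: "horocyclic_shift (R ! i) = horocyclic_shift (R ! 0)" if "i < p" for i
    using ab[OF that] ab0 b[OF that] b[OF 0] a[OF that] by simp
  have "(\<Sum>i<p. horocyclic_shift (R ! i)) = 0"
    using R(2) p by (simp add: complete_at_puncture_def)
  moreover have "(\<Sum>i<p. horocyclic_shift (R ! i)) = (\<Sum>i<p. horocyclic_shift (R ! 0))"
    by (intro sum.cong refl shift) simp
  ultimately have "real p * horocyclic_shift (R ! 0) = 0" by simp
  then have "ln (sin (2 * arctan (a 0))) = ln (sin (2 * arctan (b 0)))"
    using 0 ab0 by simp
  moreover have pos: "0 < a 0" "0 < b 0" "a 0 < b 0" using ab0 by auto
  moreover have "0 < sin (2 * arctan y)" if "0 < y" for y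
    using two_arctan_in[OF that] by (intro sin_gt_zero) auto
  ultimately have "sin (2 * arctan (a 0)) = sin (2 * arctan (b 0))" by (metis ln_inj_iff)
  then have "2 * a 0 * (1 + (b 0)\<^sup>2) = 2 * b 0 * (1 + (a 0)\<^sup>2)"
    unfolding sin_two_arctan by (subst (asm) frac_eq_eq) (smt (verit) zero_le_power2)+
  \<comment> \<open>Equal sines mean equal or supplementary angles; \<open>a 0 < b 0\<close> leaves
    the supplementary case.\<close>
  then have "(a 0 - b 0) * (1 - a 0 * b 0) = 0"
    by (simp add: algebra_simps power2_eq_square)
  then have one: "a 0 * b 0 = 1" using pos by simp
  have L0: "ln (b 0) - ln (a 0) = L" using ab0 by (simp add: side_length_def L_def)
  have "interior_angle R i = 2 * arcsin (sech (perimeter R / (2 * real p)))" if i: "i < p" for i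
  proof -
    define j where "j = (i + p - 1) mod p"
    have j: "j < p" using 0 by (simp add: j_def)
    have "interior_angle R i = (pi - 2 * arctan (b 0)) + 2 * arctan (a 0)"
      using ab[OF j] ab[OF i] b[OF j] b[OF 0] a[OF j] a[OF i]
      by (simp add: interior_angle_def p j_def)
    also have "arctan (b 0) = pi / 2 - arctan (a 0)"
      using arctan_inverse_pos[OF pos(1)] one pos by (metis nonzero_eq_divide_eq less_numeral_extra(3) mult.commute)
    finally show ?thesis
      using two_arcsin_sech[OF pos(1,3) one] unfolding L0 unfolding L by (simp add: mult.commute)
  qed
  then show "\<forall>i<p. interior_angle R i = 2 * arcsin (sech (perimeter R / (2 * real p)))" by blast
  have "hyp_area (region (R ! i)) = max_triangle_area L" if "i < p" for i
    using max_triangle_area_attained[OF pos(1,3) one] ab[OF that] b[OF that] b[OF 0] a[OF that]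
    unfolding L0 by simp
  then show "cusp_area R = p * max_triangle_area (perimeter R / p)"
    by (simp add: cusp_area_def p L)
qed

section \<open>Existence of a complete regular cusp\<close>

text \<open>Take \<open>p\<close> copies of a triangle symmetric under complex conjugation, with
  ideal vertex 1 and finite vertices on the imaginary axis.\<close>

lemma regular_cusp_exists:
  assumes "1 \<le> p" "0 < l"
  shows "\<exists>R. polygonal_cusp p R \<and> complete_at_puncture R \<and> regular_cusp R \<and> perimeter R = l"
proof -
  \<comment> \<open>Each finite vertex is at distance \<open>2 * artanh s\<close>, half of the side
    length \<open>l / p\<close>, from the centre.\<close>
  define s where "s = tanh (l / p / 4)"
  define w where "w = \<i> * complex_of_real s"
  define T where "T = Triangle w (- w) 1"
  have s: "0 < s" "s < 1" using assms by (simp_all add: s_def tanh_real_lt_1)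
  have cw: "cnj w = - w" "w * w = - of_real (s\<^sup>2)" "norm w = s"
    using s by (simp_all add: w_def norm_mult complex_eq_iff power2_eq_square)
  have "toward w (- w) = - 2 * w / (1 - w * w)" by (simp add: toward_def cw(1))
  then have tw: "toward w (- w) = - 2 * \<i> * of_real (s / (1 + s\<^sup>2))"
    by (simp add: cw(2)) (simp add: w_def)
  have t1: "toward w 1 = (1 - w) / (1 + w)" by (simp add: toward_def cw(1))
  have n: "1 - w \<noteq> 0" "1 + w \<noteq> 0" by (simp_all add: w_def complex_eq_iff)
  have cusp: "cusp_triangle T"
  proof -
    \<comment> \<open>Expanding by \<open>1 + w\<close> makes the denominator real, so the imaginary
      part can be read off.\<close>
    have "toward w (- w) / toward w 1 = - 2 * \<i> * of_real (s / (1 + s\<^sup>2)) * ((1 + w) * (1 + w) / ((1 - w) * (1 + w)))"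
      unfolding tw t1 using n by simp
    also have "(1 - w) * (1 + w) = of_real (1 + s\<^sup>2)" using cw(2) by (simp add: algebra_simps)
    also have "- 2 * \<i> * of_real (s / (1 + s\<^sup>2)) * ((1 + w) * (1 + w) / of_real (1 + s\<^sup>2))
        = - 2 * \<i> * (1 + w) * (1 + w) * of_real (s / (1 + s\<^sup>2)\<^sup>2)"
      by (simp add: power2_eq_square)
    finally have "Im (toward w (- w) / toward w 1) = - 2 * (1 - s\<^sup>2) * (s / (1 + s\<^sup>2)\<^sup>2)"
      by (simp add: w_def power2_eq_square) (simp add: minus_divide_left algebra_simps)
    moreover have "s\<^sup>2 < 1" using s by (simp add: abs_square_less_1)
    moreover have "1 + s\<^sup>2 \<noteq> 0" by (smt (verit) zero_le_power2)
    ultimately have "Im (toward w (- w) / toward w 1) \<noteq> 0" using s by simp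
    then have "toward w (- w) / toward w 1 \<notin> \<real>" by (metis complex_is_Real_iff)
    then show ?thesis using s by (simp add: cusp_triangle_def T_def cw)
  qed
  have len: "finite_side_length T = l / p"
  proof -
    have "norm (toward w (- w)) = 2 * (s / (1 + s\<^sup>2))"
      unfolding tw norm_mult norm_of_real using s by simp
    also have "\<dots> = tanh (l / p / 2)"
    proof -
      have "tanh (l / p / 2) = tanh (l / p / 4 + l / p / 4)" by simp
      also have "\<dots> = (s + s) / (1 + s * s)"
        unfolding s_def by (rule tanh_add) (simp_all add: cosh_real_nonzero)
      finally show ?thesis by (simp add: power2_eq_square)
    qed
    finally show ?thesis
      by (simp add: finite_side_length_def T_def hyp_dist_def artanh_tanh_real)
  qed
  have shift: "horocyclic_shift T = 0"
  proof -
    \<comment> \<open>By symmetry both finite vertices lie on the same horocycle at 1.\<close>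
    have "norm (1 - w) = norm (1 + w)" by (simp add: w_def cmod_def)
    then show ?thesis by (simp add: horocyclic_shift_def T_def busemann_def)
  qed
  define R where "R = replicate p T"
  have "polygonal_cusp p R" using assms cusp by (simp add: polygonal_cusp_def R_def)
  moreover have "complete_at_puncture R" using shift by (simp add: complete_at_puncture_def R_def)
  moreover have "regular_cusp R" using assms by (simp add: regular_cusp_def side_length_def interior_angle_def R_def)
  moreover have "perimeter R = l" using assms len by (simp add: perimeter_def side_length_def R_def)
  ultimately show ?thesis by blast
qed

text \<open>The existence clause keeps the maximality clause from being vacuous; the competitors
  \<open>C\<close> range over all gluings with the given perimeter.\<close>

theorem theorem1p2:
  fixes p :: nat and l :: real
  assumes "p \<ge> 1" and "l > 0"
  shows "(\<exists>R. polygonal_cusp p R \<and> complete_at_puncture R \<and> regular_cusp R \<and> perimeter R = l) \<and>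
    (\<forall>R. polygonal_cusp p R \<and> complete_at_puncture R \<and> regular_cusp R \<and> perimeter R = l \<longrightarrow>
      (\<forall>i<p. interior_angle R i = 2 * arcsin (sech (l / (2 * real p)))) \<and>
      (\<forall>C. polygonal_cusp p C \<and> perimeter C = l \<longrightarrow> cusp_area C \<le> cusp_area R))"
proof (intro conjI allI impI)
  show "\<exists>R. polygonal_cusp p R \<and> complete_at_puncture R \<and> regular_cusp R \<and> perimeter R = l"
    using regular_cusp_exists[OF assms] .
next
  fix R i
  assume "polygonal_cusp p R \<and> complete_at_puncture R \<and> regular_cusp R \<and> perimeter R = l" "i < p"
  then show "interior_angle R i = 2 * arcsin (sech (l / (2 * real p)))"
    using regular_cusp_rigidity(1) by blast
next
  fix R C
  assume "polygonal_cusp p R \<and> complete_at_puncture R \<and> regular_cusp R \<and> perimeter R = l"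
    and "polygonal_cusp p C \<and> perimeter C = l"
  then show "cusp_area C \<le> cusp_area R"
    using regular_cusp_rigidity(2)[of p R] cusp_area_le[of p C] by simp
qed

end
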